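(* Let $\Pi$ be a finite simply laced diagram with vertex set labelled by $I=\{1,\dots,n\}$, $n\ge2$, and let $\mathrm{Spin}(\Pi)$, with enveloping homomorphisms $\widetilde\tau_{ij}:\widetilde G_{ij}\to\mathrm{Spin}(\Pi)$, be the universal enveloping group of the standard $\mathrm{Spin}(2)$-amalgam $\{\widetilde G_{ij},\widetilde\phi^i_{ij}\}$ of $\Pi$. For $i\in I$ let $\widehat s_i:=\widetilde\tau_{ij}(\widetilde\phi^i_{ij}(S(\pi/4)))$ (independent of $j\ne i$), an element of order $8$, and $\widehat W:=\langle\widehat s_i\mid i\in I\rangle\le\mathrm{Spin}(\Pi)$. Then $r_i\mapsto\widehat s_i$ extends to an isomorphism from the group $W^{\mathrm{spin}}(\Pi)$ with presentation $\langle r_1,\dots,r_n\mid r_i^8=1;\ r_i^{-1}r_j^2r_i=r_j^2r_i^{2n(i,j)}\ (i\ne j);\ r_ir_jr_i\cdots=r_jr_ir_j\cdots\ (m_{ij}\text{ factors each side},\ i\ne j)\rangle$ onto $\widehat W$, where $m_{ij}=3$, $n(i,j)=1$ if $i,j$ are adjacent and $m_{ij}=2$, $n(i,j)=0$ otherwise.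
   Context: $\mathrm{Spin}(m)$ lives in the Clifford algebra with $e_k^2=-1$, $e_ke_l=-e_le_k$; $S(\alpha)=\cos\alpha+\sin\alpha\,e_1e_2\in\mathrm{Spin}(2)$. Standard $\mathrm{Spin}(2)$-amalgam of simply laced $\Pi$: for $i<j$ adjacent, $\widetilde G_{ij}=\mathrm{Spin}(3)$ with $\widetilde\phi^i_{ij}(a+be_1e_2)=a+be_1e_2$ and $\widetilde\phi^j_{ij}(a+be_1e_2)=a+be_2e_3$; for $i<j$ non-adjacent, $\widetilde G_{ij}=\mathrm{Spin}(2)\times\mathrm{Spin}(2)$ with $\widetilde\phi^i_{ij}(x)=(x,1)$, $\widetilde\phi^j_{ij}(x)=(1,x)$. A universal enveloping group of an amalgam $\{G_{ij},\phi^i_{ij}\}$ is a group $G$ with homomorphisms $\tau_{ij}:G_{ij}\to G$ whose images generate $G$, with $\tau_{ij}\circ\phi^j_{ij}=\tau_{kj}\circ\phi^j_{kj}$ for pairwise distinct $i,j,k$, through which every other such family factors uniquely (e.g. the group generated by all $G_{ij}$ subject to their relations and the identifications $\phi^j_{ij}(x)=\phi^j_{kj}(x)$). *)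

theory Defs
  imports Complex_Main "HOL-Algebra.Multiplicative_Group" "HOL-Algebra.Generated_Groups"
begin

inductive wcong :: "('a list \<Rightarrow> 'a list \<Rightarrow> bool) \<Rightarrow> 'a list \<Rightarrow> 'a list \<Rightarrow> bool"
  for R where
  wc_base: "R u v \<Longrightarrow> wcong R (x @ u @ y) (x @ v @ y)"
| wc_refl: "wcong R u u"
| wc_sym: "wcong R u v \<Longrightarrow> wcong R v u"
| wc_trans: "wcong R u v \<Longrightarrow> wcong R v w \<Longrightarrow> wcong R u w"

definition wclass :: "('a list \<Rightarrow> 'a list \<Rightarrow> bool) \<Rightarrow> 'a list \<Rightarrow> 'a list set" where
  "wclass R w = {v. wcong R w v}"

definition word_group :: "'a set \<Rightarrow> ('a list \<Rightarrow> 'a list \<Rightarrow> bool) \<Rightarrow> 'a list set monoid" where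
  "word_group L R =
     \<lparr>carrier = wclass R ` lists L,
      mult = (\<lambda>A B. {v. \<exists>a\<in>A. \<exists>b\<in>B. wcong R (a @ b) v}),
      one = wclass R []\<rparr>"

text \<open>A multivector is a real coefficient function on the blades e_A, A a finite
  set of indices (e_A = e_a1 ... e_ak for a1 < ... < ak).\<close>
type_synonym mv = "nat set \<Rightarrow> real"

text \<open>e_A e_B = (-1)^(#{(a,b) in A x B. b < a} + |A \<inter> B|) e_(A \<triangle> B)
  (using e_k e_l = - e_l e_k for k \<noteq> l and e_k^2 = -1).\<close>
definition cl_sign :: "nat set \<Rightarrow> nat set \<Rightarrow> real" where
  "cl_sign A B = (-1) ^ (card {(a, b). a \<in> A \<and> b \<in> B \<and> b < a} + card (A \<inter> B))"

definition cl_mult :: "nat \<Rightarrow> mv \<Rightarrow> mv \<Rightarrow> mv" where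
  "cl_mult m x y = (\<lambda>C. \<Sum>A\<in>Pow {1..m}. \<Sum>B\<in>Pow {1..m}.
       if (A - B) \<union> (B - A) = C then cl_sign A B * x A * y B else 0)"

definition cl_one :: mv where
  "cl_one = (\<lambda>C. if C = {} then 1 else 0)"

definition cl_vec :: "nat \<Rightarrow> (nat \<Rightarrow> real) \<Rightarrow> mv" where
  "cl_vec m v = (\<lambda>C. if card C = 1 \<and> C \<subseteq> {1..m} then v (the_elem C) else 0)"

definition unit_vec :: "nat \<Rightarrow> (nat \<Rightarrow> real) \<Rightarrow> bool" where
  "unit_vec m v \<longleftrightarrow> (\<Sum>k=1..m. (v k)\<^sup>2) = 1"

definition spin :: "nat \<Rightarrow> mv set" where
  "spin m = {foldr (cl_mult m) (map (cl_vec m) vs) cl_one | vs.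
               even (length vs) \<and> (\<forall>v\<in>set vs. unit_vec m v)}"

definition spin_grp :: "nat \<Rightarrow> mv monoid" where
  "spin_grp m = \<lparr>carrier = spin m, mult = cl_mult m, one = cl_one\<rparr>"

definition cl_ab :: "real \<Rightarrow> real \<Rightarrow> nat set \<Rightarrow> mv" where
  "cl_ab a b A = (\<lambda>C. if C = {} then a else if C = A then b else 0)"

definition S_rot :: "real \<Rightarrow> mv" where
  "S_rot \<alpha> = cl_ab (cos \<alpha>) (sin \<alpha>) {1, 2}"

text \<open>All rank-2 groups are encoded on the common type mv \<times> mv: for adjacent
  i < j the group Spin(3) is encoded as x \<mapsto> (x, 1); for non-adjacent i < j the
  group is the direct product Spin(2) \<times> Spin(2).\<close>
definition G_adj :: "(mv \<times> mv) monoid" where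
  "G_adj = \<lparr>carrier = (\<lambda>x. (x, cl_one)) ` spin 3,
            mult = (\<lambda>p q. (cl_mult 3 (fst p) (fst q), cl_one)),
            one = (cl_one, cl_one)\<rparr>"

definition G_nonadj :: "(mv \<times> mv) monoid" where
  "G_nonadj = spin_grp 2 \<times>\<times> spin_grp 2"

definition Gpair :: "(nat \<Rightarrow> nat \<Rightarrow> bool) \<Rightarrow> nat \<times> nat \<Rightarrow> (mv \<times> mv) monoid" where
  "Gpair adj p = (if adj (fst p) (snd p) then G_adj else G_nonadj)"

definition pair :: "nat \<Rightarrow> nat \<Rightarrow> nat \<times> nat" where
  "pair i j = (min i j, max i j)"

text \<open>emb adj i j: the embedding of the Spin(2) of vertex i into the group of
  the pair {i,j}; i.e. phi^i_{ij} if i < j and phi^i_{ji} if j < i.\<close>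
definition emb :: "(nat \<Rightarrow> nat \<Rightarrow> bool) \<Rightarrow> nat \<Rightarrow> nat \<Rightarrow> mv \<Rightarrow> mv \<times> mv" where
  "emb adj i j x =
     (if adj i j then
        (if i < j then (cl_ab (x {}) (x {1,2}) {1,2}, cl_one)
         else (cl_ab (x {}) (x {1,2}) {2,3}, cl_one))
      else
        (if i < j then (x, cl_one) else (cl_one, x)))"

definition amal_letters :: "nat \<Rightarrow> (nat \<Rightarrow> nat \<Rightarrow> bool) \<Rightarrow> ((nat \<times> nat) \<times> (mv \<times> mv)) set" where
  "amal_letters n adj = {((i, j), g). i \<in> {1..n} \<and> j \<in> {1..n} \<and> i < j \<and>
                                       g \<in> carrier (Gpair adj (i, j))}"

definition amal_rel :: "nat \<Rightarrow> (nat \<Rightarrow> nat \<Rightarrow> bool) \<Rightarrow>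
    ((nat \<times> nat) \<times> (mv \<times> mv)) list \<Rightarrow> ((nat \<times> nat) \<times> (mv \<times> mv)) list \<Rightarrow> bool" where
  "amal_rel n adj u v \<longleftrightarrow>
     (\<exists>p g h. (p, g) \<in> amal_letters n adj \<and> (p, h) \<in> amal_letters n adj \<and>
        u = [(p, g), (p, h)] \<and> v = [(p, g \<otimes>\<^bsub>Gpair adj p\<^esub> h)])
   \<or> (\<exists>p. (p, \<one>\<^bsub>Gpair adj p\<^esub>) \<in> amal_letters n adj \<and> u = [(p, \<one>\<^bsub>Gpair adj p\<^esub>)] \<and> v = [])
   \<or> (\<exists>i j k x. i \<in> {1..n} \<and> j \<in> {1..n} \<and> k \<in> {1..n} \<and> i \<noteq> j \<and> j \<noteq> k \<and> i \<noteq> k \<and>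
        x \<in> spin 2 \<and>
        u = [(pair i j, emb adj i j x)] \<and> v = [(pair i k, emb adj i k x)])"

text \<open>Spin(Pi): the universal enveloping group of the standard Spin(2)-amalgam,
  realised as the group generated by all G_ij subject to their relations and the
  identifications.\<close>
definition SpinPi :: "nat \<Rightarrow> (nat \<Rightarrow> nat \<Rightarrow> bool) \<Rightarrow> ((nat \<times> nat) \<times> (mv \<times> mv)) list set monoid" where
  "SpinPi n adj = word_group (amal_letters n adj) (amal_rel n adj)"

definition tau :: "nat \<Rightarrow> (nat \<Rightarrow> nat \<Rightarrow> bool) \<Rightarrow> nat \<times> nat \<Rightarrow> mv \<times> mv \<Rightarrow>
    ((nat \<times> nat) \<times> (mv \<times> mv)) list set" where
  "tau n adj p g = wclass (amal_rel n adj) [(p, g)]"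

definition s_hat_via :: "nat \<Rightarrow> (nat \<Rightarrow> nat \<Rightarrow> bool) \<Rightarrow> nat \<Rightarrow> nat \<Rightarrow>
    ((nat \<times> nat) \<times> (mv \<times> mv)) list set" where
  "s_hat_via n adj i j = tau n adj (pair i j) (emb adj i j (S_rot (pi / 4)))"

definition s_hat :: "nat \<Rightarrow> (nat \<Rightarrow> nat \<Rightarrow> bool) \<Rightarrow> nat \<Rightarrow>
    ((nat \<times> nat) \<times> (mv \<times> mv)) list set" where
  "s_hat n adj i = s_hat_via n adj i (if i = 1 then 2 else 1)"

definition W_hat :: "nat \<Rightarrow> (nat \<Rightarrow> nat \<Rightarrow> bool) \<Rightarrow> ((nat \<times> nat) \<times> (mv \<times> mv)) list set monoid" where
  "W_hat n adj = (SpinPi n adj)\<lparr>carrier := generate (SpinPi n adj) (s_hat n adj ` {1..n})\<rparr>"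

text \<open>Letters (i, True) = r_i, (i, False) = r_i^{-1}.\<close>
definition gen_pow :: "nat \<Rightarrow> nat \<Rightarrow> (nat \<times> bool) list" where
  "gen_pow i k = replicate k (i, True)"

definition alt_word :: "nat \<Rightarrow> nat \<Rightarrow> nat \<Rightarrow> (nat \<times> bool) list" where
  "alt_word i j m = map (\<lambda>t. (if even t then i else j, True)) [0..<m]"

definition m_coef :: "(nat \<Rightarrow> nat \<Rightarrow> bool) \<Rightarrow> nat \<Rightarrow> nat \<Rightarrow> nat" where
  "m_coef adj i j = (if adj i j then 3 else 2)"

definition n_coef :: "(nat \<Rightarrow> nat \<Rightarrow> bool) \<Rightarrow> nat \<Rightarrow> nat \<Rightarrow> nat" where
  "n_coef adj i j = (if adj i j then 1 else 0)"

definition wspin_rel :: "nat \<Rightarrow> (nat \<Rightarrow> nat \<Rightarrow> bool) \<Rightarrow>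
    (nat \<times> bool) list \<Rightarrow> (nat \<times> bool) list \<Rightarrow> bool" where
  "wspin_rel n adj u v \<longleftrightarrow>
     (\<exists>i\<in>{1..n}. \<exists>b. u = [(i, b), (i, \<not> b)] \<and> v = [])
   \<or> (\<exists>i\<in>{1..n}. u = gen_pow i 8 \<and> v = [])
   \<or> (\<exists>i\<in>{1..n}. \<exists>j\<in>{1..n}. i \<noteq> j \<and>
        u = [(i, False)] @ gen_pow j 2 @ [(i, True)] \<and>
        v = gen_pow j 2 @ gen_pow i (2 * n_coef adj i j))
   \<or> (\<exists>i\<in>{1..n}. \<exists>j\<in>{1..n}. i \<noteq> j \<and>
        u = alt_word i j (m_coef adj i j) \<and> v = alt_word j i (m_coef adj i j))"

definition Wspin :: "nat \<Rightarrow> (nat \<Rightarrow> nat \<Rightarrow> bool) \<Rightarrow> (nat \<times> bool) list set monoid" where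
  "Wspin n adj = word_group ({1..n} \<times> UNIV) (wspin_rel n adj)"

definition r_gen :: "nat \<Rightarrow> (nat \<Rightarrow> nat \<Rightarrow> bool) \<Rightarrow> nat \<Rightarrow> (nat \<times> bool) list set" where
  "r_gen n adj i = wclass (wspin_rel n adj) [(i, True)]"

end

(*
  Checking the defining relations inside Spin(3) and Spin(2) x Spin(2) gives a surjection from
  W^spin onto the group generated by the s_i; the point is its injectivity. For this, Spin(Pi) acts on
  (R + V) (x) S, where S is the generalized spin representation (generators g_i with g_i^2 = -1
  that anticommute or commute according to adjacency) and V is the reflection representation of
  the Coxeter group. On V (x) S the Lie algebra generator of the vertex i acts by
  (1/2 - alpha_i (alpha_i, .)) (x) g_i, which integrates to a spin 3/2 representation of the Spin(3)
  of each edge, and s_i acts by the simple reflection tensored with (1 + g_i) / sqrt 2. If w acts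
  trivially, it therefore acts trivially on V, and by faithfulness of the reflection representation
  (Tits) w is a product of squares r_i^2. These act on S by g_i, so every index occurs an even
  number of times and w is a product of the central elements r_i^4, which depend only on the
  component of i; letting one component act at a time shows that each of them cancels.
*)
theory Submission
  imports Defs "HOL-Computational_Algebra.Primes"
begin

text \<open>The reflection representation V cannot itself extend to \<open>SpinPi\<close>: S(pi/4)
  is the square of S(pi/8), so its determinant would be a square, while a reflection has determinant
  -1. On V (x) S this obstruction disappears: the circle of vertex i acts by cos t + sin t g_i on
  the part orthogonal to alpha_i and by cos 3t - sin 3t g_i along alpha_i, from the eigenvalues 1/2
  and -3/2 of the generator. At t = pi/4 the second is minus the first, which gives the simple
  reflection; at t = pi/2 they agree, so squares do not move V. The tensor product costs a scalar: a
  (x) b = 1 determines a and b only up to reciprocal factors. The summand R removes this ambiguity: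
  reflections fix it, so b = 1 is read off on R (x) S, and a = 1 follows. Exponentials are avoided:
  the action of an edge is written down as an explicit matrix of quaternions. Since the amalgam only
  involves pairs of vertices, nothing beyond rank two has to be checked.\<close>

section \<open>Words modulo relations\<close>

lemma wcong_append:
  assumes "wcong R u u'" "wcong R v v'"
  shows "wcong R (u @ v) (u' @ v')"
proof -
  have left: "wcong R (x @ u) (x @ u')" if "wcong R u u'" for x u u'
    using that
  proof induction
    case (wc_base u v y z)
    then show ?case using wcong.wc_base[of R u v "x @ y" z] by simp
  qed (auto intro: wcong.intros)
  have right: "wcong R (u @ x) (u' @ x)" if "wcong R u u'" for x u u'
    using that
  proof induction
    case (wc_base u v y z)
    then show ?case using wcong.wc_base[of R u v y "z @ x"] by simp
  qed (auto intro: wcong.intros)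
  show ?thesis using left[OF assms(2)] right[OF assms(1)] by (meson wc_trans)
qed

lemma wcong_subst: "wcong R u v \<Longrightarrow> wcong R (x @ u @ y) (x @ v @ y)"
  by (intro wcong_append wc_refl)

lemma wcong_rel: "R u v \<Longrightarrow> wcong R u v"
  using wc_base[of R u v "[]" "[]"] by simp

lemmas wcong_appendL = wcong_append[OF wc_refl]
lemmas wcong_appendR = wcong_append[OF _ wc_refl]

declare wc_trans [trans]

text \<open>The source of all invariants below: parity of lengths, the Coxeter action on V, and the
  operators of words on vector-spinors.\<close>

lemma wcong_invariant:
  assumes "wcong R u v" "\<And>u v x y. R u v \<Longrightarrow> f (x @ u @ y) = f (x @ v @ y)"
  shows "f u = f v"
  using assms(1) by induction (auto simp: assms(2))

lemma wclass_eq_iff: "wclass R u = wclass R v \<longleftrightarrow> wcong R u v"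
  unfolding wclass_def by (auto intro: wc_refl wc_sym wc_trans)

lemma word_group_simps:
  "carrier (word_group L R) = wclass R ` lists L"
  "\<one>\<^bsub>word_group L R\<^esub> = wclass R []"
  by (simp_all add: word_group_def)

lemma word_group_mult: "wclass R u \<otimes>\<^bsub>word_group L R\<^esub> wclass R v = wclass R (u @ v)"
  unfolding word_group_def wclass_def
  by (auto intro: wc_refl wc_sym wc_trans dest: wcong_append)

lemma word_group_pow: "wclass R u [^]\<^bsub>word_group L R\<^esub> (k::nat) = wclass R (concat (replicate k u))"
proof (induction k)
  case (Suc k)
  have "concat (replicate (Suc k) u) = concat (replicate k u @ [u])"
    by (simp only: replicate_Suc replicate_append_same)
  then show ?case using Suc by (simp add: word_group_mult)
qed (simp add: word_group_simps)

text \<open>The alphabet need not contain formal inverses. In \<open>SpinPi\<close> the inverse of a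
  letter is another element of the same rank-two group.\<close>

lemma group_word_group:
  assumes "\<And>a. a \<in> L \<Longrightarrow> \<exists>b\<in>L. wcong R [b, a] []"
  shows "group (word_group L R)"
proof (rule groupI)
  fix x assume "x \<in> carrier (word_group L R)"
  then obtain w where w: "w \<in> lists L" "x = wclass R w" by (auto simp: word_group_simps)
  have "\<exists>v\<in>lists L. wcong R (v @ w) []" using w(1)
  proof induction
    case Nil
    then show ?case by (auto intro!: bexI[of _ "[]"] wc_refl)
  next
    case (Cons a w)
    then obtain v b where v: "v \<in> lists L" "wcong R (v @ w) []" "b \<in> L" "wcong R [b, a] []"
      using assms by blast
    have "wcong R ((v @ [b]) @ a # w) (v @ w)"
      using wcong_subst[OF v(4), of v w] by simp
    with v show ?case by (intro bexI[of _ "v @ [b]"]) (auto intro: wc_trans)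
  qed
  then obtain v where "v \<in> lists L" "wcong R (v @ w) []" by blast
  then show "\<exists>y\<in>carrier (word_group L R). y \<otimes>\<^bsub>word_group L R\<^esub> x = \<one>\<^bsub>word_group L R\<^esub>"
    using w by (intro bexI[of _ "wclass R v"]) (auto simp: word_group_mult word_group_simps wclass_eq_iff)
qed (auto simp: word_group_mult word_group_simps intro!: imageI)

lemma word_group_inv_letter:
  assumes "group (word_group L R)" "u \<in> lists L" "v \<in> lists L" "wcong R (v @ u) []"
  shows "inv\<^bsub>word_group L R\<^esub> (wclass R u) = wclass R v"
proof -
  interpret group "word_group L R" by fact
  show ?thesis using assms(2-)
    by (intro inv_equality) (auto simp: word_group_mult word_group_simps wclass_eq_iff)
qed

section \<open>Faithfulness of the reflection representation\<close>

definition cox_rel :: "nat \<Rightarrow> (nat \<Rightarrow> nat \<Rightarrow> bool) \<Rightarrow> nat list \<Rightarrow> nat list \<Rightarrow> bool" where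
  "cox_rel n adj u v \<longleftrightarrow>
     (\<exists>i\<in>{1..n}. u = [i, i] \<and> v = [])
   \<or> (\<exists>i\<in>{1..n}. \<exists>j\<in>{1..n}. i \<noteq> j \<and> adj i j \<and> u = [i, j, i] \<and> v = [j, i, j])
   \<or> (\<exists>i\<in>{1..n}. \<exists>j\<in>{1..n}. i \<noteq> j \<and> \<not> adj i j \<and> u = [i, j] \<and> v = [j, i])"

text \<open>The pairing (alpha_i, v) for v given by its coordinates in the simple roots. These
  remain independent even when the Cartan matrix is singular, which faithfulness requires.\<close>

definition cartan :: "nat \<Rightarrow> (nat \<Rightarrow> nat \<Rightarrow> bool) \<Rightarrow> nat \<Rightarrow> (nat \<Rightarrow> real) \<Rightarrow> real" where
  "cartan n adj i v = 2 * v i - (\<Sum>l\<in>{l\<in>{1..n}. adj i l}. v l)"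

definition simple_refl :: "nat \<Rightarrow> (nat \<Rightarrow> nat \<Rightarrow> bool) \<Rightarrow> nat \<Rightarrow> (nat \<Rightarrow> real) \<Rightarrow> nat \<Rightarrow> real" where
  "simple_refl n adj i v = v(i := v i - cartan n adj i v)"

locale diagram =
  fixes n :: nat and adj :: "nat \<Rightarrow> nat \<Rightarrow> bool"
  assumes adj_sym: "i \<in> {1..n} \<Longrightarrow> j \<in> {1..n} \<Longrightarrow> adj i j = adj j i"
    and adj_irrefl: "i \<in> {1..n} \<Longrightarrow> \<not> adj i i"
begin

abbreviation cox_eq (infix "\<approx>" 50) where "u \<approx> v \<equiv> wcong (cox_rel n adj) u v"

definition act :: "nat list \<Rightarrow> (nat \<Rightarrow> real) \<Rightarrow> nat \<Rightarrow> real" where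
  "act u = foldr (simple_refl n adj) u"

definition simple_root :: "nat \<Rightarrow> nat \<Rightarrow> real" where
  "simple_root i = (\<lambda>k. if k = i then 1 else 0)"

definition reduced :: "nat list \<Rightarrow> bool" where
  "reduced u \<longleftrightarrow> u \<in> lists {1..n} \<and> (\<forall>v. u \<approx> v \<longrightarrow> length u \<le> length v)"

lemma act_simps [simp]: "act [] v = v" "act (i # u) v = simple_refl n adj i (act u v)"
  "act (u @ w) v = act u (act w v)"
  by (simp_all add: act_def)

lemma cox_lists: "u \<approx> v \<Longrightarrow> u \<in> lists {1..n} \<longleftrightarrow> v \<in> lists {1..n}"
  by (erule wcong_invariant[where f = "\<lambda>u. u \<in> lists {1..n}"]) (auto simp: cox_rel_def)

lemma cox_parity: "u \<approx> v \<Longrightarrow> even (length u) \<longleftrightarrow> even (length v)"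
  by (erule wcong_invariant[where f = "\<lambda>u. even (length u)"]) (auto simp: cox_rel_def)

lemma sum_fun_upd:
  fixes v :: "'a \<Rightarrow> real"
  assumes "finite S"
  shows "(\<Sum>l\<in>S. (v(i := a)) l) = (\<Sum>l\<in>S. v l) + (if i \<in> S then a - v i else 0)"
proof (cases "i \<in> S")
  case True
  have "(\<Sum>l\<in>S - {i}. (v(i := a)) l) = (\<Sum>l\<in>S - {i}. v l)" by (intro sum.cong) auto
  with True assms show ?thesis by (simp add: sum.remove[of S i])
next
  case False
  then show ?thesis by (auto intro!: sum.cong)
qed

lemma cartan_upd:
  assumes "i \<in> {1..n}" "j \<in> {1..n}"
  shows "cartan n adj j (v(i := a)) =
    cartan n adj j v + (a - v i) * (if i = j then 2 else if adj i j then -1 else 0)"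
  using assms adj_sym adj_irrefl
  by (auto simp: cartan_def sum_fun_upd algebra_simps simp del: fun_upd_apply) auto

lemma simple_refl_relations:
  assumes "i \<in> {1..n}"
  shows "simple_refl n adj i (simple_refl n adj i v) = v"
    and "\<lbrakk>j \<in> {1..n}; i \<noteq> j; \<not> adj i j\<rbrakk> \<Longrightarrow> simple_refl n adj i (simple_refl n adj j v) = simple_refl n adj j (simple_refl n adj i v)"
    and "\<lbrakk>j \<in> {1..n}; i \<noteq> j; adj i j\<rbrakk> \<Longrightarrow> simple_refl n adj i (simple_refl n adj j (simple_refl n adj i v)) = simple_refl n adj j (simple_refl n adj i (simple_refl n adj j v))"
  using assms adj_sym adj_irrefl
  by (auto simp: simple_refl_def cartan_upd fun_eq_iff)

lemma cox_act: "u \<approx> v \<Longrightarrow> act u = act v"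
proof (erule wcong_invariant)
  fix u v x y assume "cox_rel n adj u v"
  then have "act u w = act v w" for w
    unfolding cox_rel_def using simple_refl_relations by (elim disjE bexE conjE) simp_all
  then show "act (x @ u @ y) = act (x @ v @ y)" by (rule_tac ext) simp
qed

lemma cartan_simple_root:
  assumes "i \<in> {1..n}" "j \<in> {1..n}"
  shows "cartan n adj j (simple_root i) = (if i = j then 2 else if adj i j then -1 else 0)"
  using cartan_upd[OF assms, of "\<lambda>k. 0" 1]
  by (simp add: simple_root_def fun_upd_def cartan_def cong: if_cong)

lemma cartan_add: "cartan n adj i (\<lambda>k. v k + w k) = cartan n adj i v + cartan n adj i w"
  by (simp add: cartan_def sum.distrib)

lemma simple_refl_root:
  assumes "s \<in> {1..n}" "t \<in> {1..n}"
  shows "simple_refl n adj s (simple_root s) = (\<lambda>k. - simple_root s k)"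
    and "s \<noteq> t \<Longrightarrow> \<not> adj s t \<Longrightarrow> simple_refl n adj t (simple_root s) = simple_root s"
    and "s \<noteq> t \<Longrightarrow> adj s t \<Longrightarrow> simple_refl n adj t (simple_root s) = (\<lambda>k. simple_root s k + simple_root t k)"
    and "s \<noteq> t \<Longrightarrow> adj s t \<Longrightarrow> simple_refl n adj t (\<lambda>k. simple_root s k + simple_root t k) = simple_root s"
  using assms adj_sym[OF assms] adj_irrefl[OF assms(1)] adj_irrefl[OF assms(2)]
  by (auto simp: simple_refl_def cartan_simple_root cartan_add fun_eq_iff) (auto simp: simple_root_def)

lemma act_linear:
  "act u (\<lambda>k. v k + w k) = (\<lambda>k. act u v k + act u w k)" "act u (\<lambda>k. - v k) = (\<lambda>k. - act u v k)"
  by (induction u)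
     (auto simp: simple_refl_def cartan_def fun_eq_iff sum.distrib algebra_simps sum_negf)

lemma reduced_appendD:
  assumes "reduced (u @ v)" shows "reduced u"
proof -
  have "length u \<le> length w" if "u \<approx> w" for w
    using assms that wcong_append[OF that wc_refl, of v] unfolding reduced_def by fastforce
  then show ?thesis using assms by (auto simp: reduced_def)
qed

lemma cox_cancel: "i \<in> {1..n} \<Longrightarrow> u @ [i, i] @ v \<approx> u @ v"
  using wc_base[of "cox_rel n adj" "[i, i]" "[]" u v] by (auto simp: cox_rel_def)

lemma reduced_le: "reduced u \<Longrightarrow> u \<approx> v \<Longrightarrow> length u \<le> length v"
  by (auto simp: reduced_def)

text \<open>Tits' argument: if lengthening u by s keeps it reduced, then u sends alpha_s to a
  nonnegative combination of simple roots. The induction strips the last letter t of u and works in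
  the dihedral group of s and t; with m at most 3, at most one further letter has to be
  stripped.\<close>

lemma act_root_nonneg:
  "reduced (u @ [s]) \<Longrightarrow> 0 \<le> act u (simple_root s) k"
proof (induction "length u" arbitrary: u s k rule: less_induct)
  case less
  note red = less.prems
  have s: "s \<in> {1..n}" using red by (simp add: reduced_def)
  show ?case
  proof (cases u rule: rev_cases)
    case Nil
    then show ?thesis by (simp add: simple_root_def)
  next
    case u: (snoc w t)
    have t: "t \<in> {1..n}" and w: "w \<in> lists {1..n}" using red u by (auto simp: reduced_def)
    have redu: "reduced (w @ [t])" using reduced_appendD[OF red] u by simp
    then have redw: "reduced w" by (rule reduced_appendD)
    have "s \<noteq> t"
      using reduced_le[OF red, of w] cox_cancel[OF s, of w "[]"] u by auto
    show ?thesis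
    proof (cases "adj s t")
      case False
      have eq: "u @ [s] \<approx> (w @ [s]) @ [t]"
        using wc_base[of "cox_rel n adj" "[t, s]" "[s, t]" w "[]"] False s t \<open>s \<noteq> t\<close> adj_sym u
        by (auto simp: cox_rel_def)
      have "reduced (w @ [s])"
        unfolding reduced_def
      proof (intro conjI allI impI)
        fix v assume "w @ [s] \<approx> v"
        then have "u @ [s] \<approx> v @ [t]" using eq wcong_appendR wc_trans by blast
        then show "length (w @ [s]) \<le> length v" using reduced_le[OF red] u by fastforce
      qed (use s w in auto)
      then have "0 \<le> act w (simple_root s) k" using less.hyps[of w s] u by auto
      then show ?thesis using simple_refl_root(2)[OF s t] False \<open>s \<noteq> t\<close> u by simp
    next
      case True
      have *: "act u (simple_root s) k = act w (simple_root s) k + act w (simple_root t) k"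
        using simple_refl_root(3)[OF s t] True \<open>s \<noteq> t\<close> u by (simp add: act_linear)
      show ?thesis
      proof (cases "reduced (w @ [s])")
        case True
        then show ?thesis using * less.hyps[of w] redu u by auto
      next
        case nred: False
        then obtain v where v: "w @ [s] \<approx> v" "length v \<le> length w"
          using s w by (auto simp: reduced_def not_le)
        \<comment> \<open>All relations preserve the parity of the length, so the length of v
          differs from that of w.\<close>
        have len: "length v < length w"
          using cox_parity[OF v(1)] v(2) by (cases "length v = length w") auto
        have wv: "w \<approx> v @ [s]"
          using wcong_appendR[OF v(1), of "[s]"] cox_cancel[OF s, of w "[]"] wc_sym wc_trans by fastforce
        have lenw: "length w = Suc (length v)" using reduced_le[OF redw wv] len by simp
        have "u @ [s] \<approx> v @ [s, t, s]" using wcong_appendR[OF wv, of "[t, s]"] u by simp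
        also have "v @ [s, t, s] \<approx> v @ [t, s, t]"
          using wc_base[of "cox_rel n adj" "[s, t, s]" "[t, s, t]" v "[]"] True s t \<open>s \<noteq> t\<close>
          by (auto simp: cox_rel_def)
        finally have eq: "u @ [s] \<approx> (v @ [t]) @ [s, t]" by simp
        have "reduced (v @ [t])" unfolding reduced_def
        proof (intro conjI allI impI)
          show "v @ [t] \<in> lists {1..n}" using cox_lists[OF v(1)] s t w by auto
          fix x assume "v @ [t] \<approx> x"
          then have "u @ [s] \<approx> x @ [s, t]" using eq wcong_appendR wc_trans by blast
          then show "length (v @ [t]) \<le> length x" using reduced_le[OF red] u lenw by fastforce
        qed
        then have "0 \<le> act v (simple_root t) k" using less.hyps[of v t] u lenw by auto
        \<comment> \<open>u acts as v s t, and s t alpha_s = s (alpha_s + alpha_t) =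
          alpha_t.\<close>
        moreover have "act u (simple_root s) = act v (simple_root t)"
          using u cox_act[OF wv] simple_refl_root(3)[OF s t] simple_refl_root(4)[OF t s] True adj_sym[OF s t] \<open>s \<noteq> t\<close>
          by (simp add: add.commute)
        ultimately show ?thesis by simp
      qed
    qed
  qed
qed

text \<open>A nonempty shortest representative w s would send alpha_s to the negative of a
  nonnegative vector, whereas the identity keeps its coordinate 1.\<close>

lemma act_faithful:
  assumes "u \<in> lists {1..n}" "act u = id"
  shows "u \<approx> []"
proof -
  obtain v where v: "u \<approx> v" "\<And>w. u \<approx> w \<Longrightarrow> length v \<le> length w"
    using ex_has_least_nat[of "\<lambda>v. u \<approx> v" u length] wc_refl by metis
  have red: "reduced v" 
    using v assms(1) cox_lists[OF v(1)] by (auto simp: reduced_def intro: wc_trans)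
  have "v = []"
  proof (cases v rule: rev_cases)
    case (snoc w s)
    have s: "s \<in> {1..n}" using red snoc by (auto simp: reduced_def)
    have "act v (simple_root s) s = 1" using cox_act[OF v(1)] assms(2) by (simp add: simple_root_def)
    moreover have "act v (simple_root s) s = - act w (simple_root s) s"
      using simple_refl_root(1)[OF s s] snoc by (simp add: act_linear)
    ultimately show ?thesis using act_root_nonneg[of w s s] red snoc by simp
  qed
  then show ?thesis using v(1) by simp
qed

end

section \<open>Spin groups in dimensions 2 and 3\<close>

text \<open>Blades multiply by symmetric difference, so A and the target C determine the second
  factor and the double sum collapses.\<close>

lemma cl_mult_eq:
  "cl_mult m x y C = (if C \<subseteq> {1..m} then
     \<Sum>A\<in>Pow {1..m}. cl_sign A (sym_diff A C) * x A * y (sym_diff A C) else 0)"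
proof (cases "C \<subseteq> {1..m}")
  case True
  have "(\<Sum>B\<in>Pow {1..m}. if sym_diff A B = C then cl_sign A B * x A * y B else 0) =
      cl_sign A (sym_diff A C) * x A * y (sym_diff A C)" if "A \<in> Pow {1..m}" for A
  proof -
    have "sym_diff A B = C \<longleftrightarrow> B = sym_diff A C" for B by blast
    moreover have "sym_diff A C \<in> Pow {1..m}" using True that by blast
    ultimately show ?thesis by (simp add: sum.delta)
  qed
  with True show ?thesis unfolding cl_mult_def by (auto intro!: sum.cong)
next
  case False
  have "sym_diff A B \<noteq> C" if "A \<in> Pow {1..m}" "B \<in> Pow {1..m}" for A B using that False by blast
  then show ?thesis unfolding cl_mult_def using False by (auto intro!: sum.neutral)
qed

lemma sum_Pow_insert:
  assumes "finite A" "a \<notin> A"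
  shows "(\<Sum>X\<in>Pow (insert a A). f X) = (\<Sum>X\<in>Pow A. f X + f (insert a X))"
proof -
  have "inj_on (insert a) (Pow A)" using assms(2)
    by (intro inj_onI) (metis Diff_insert_absorb PowD subsetD)
  moreover have "Pow A \<inter> insert a ` Pow A = {}" using assms(2) by auto
  ultimately show ?thesis using assms(1)
    by (simp add: Pow_insert sum.union_disjoint sum.reindex sum.distrib)
qed

text \<open>Membership of 1, 2, 3 is encoded by truth values, so that Clifford products become
  finite sums over \<open>bool\<close> that the simplifier evaluates.\<close>

definition mv3 :: "(bool \<Rightarrow> bool \<Rightarrow> bool \<Rightarrow> real) \<Rightarrow> mv" where
  "mv3 f C = (if C \<subseteq> {1..3} then f (1 \<in> C) (2 \<in> C) (3 \<in> C) else 0)"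

definition mv2 :: "(bool \<Rightarrow> bool \<Rightarrow> real) \<Rightarrow> mv" where
  "mv2 f C = (if C \<subseteq> {1..2} then f (1 \<in> C) (2 \<in> C) else 0)"

text \<open>The first three summands count the inversions e_2 e_1, e_3 e_1, e_3 e_2; the last three
  come from e_k^2 = -1.\<close>

definition sgn3 :: "bool \<Rightarrow> bool \<Rightarrow> bool \<Rightarrow> bool \<Rightarrow> bool \<Rightarrow> bool \<Rightarrow> real" where
  "sgn3 a b c p q r = (-1) ^ (of_bool (b \<and> p) + of_bool (c \<and> p) + of_bool (c \<and> q)
     + of_bool (a \<and> p) + of_bool (b \<and> q) + of_bool (c \<and> r))"

lemma atLeastAtMost_1_3: "{1..3} = {1, 2, 3::nat}" and atLeastAtMost_1_2: "{1..2} = {1, 2::nat}"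
  by auto

lemma cl_sign_3:
  assumes "A \<subseteq> {1..3}" "B \<subseteq> {1..3}"
  shows "cl_sign A B = sgn3 (1 \<in> A) (2 \<in> A) (3 \<in> A) (1 \<in> B) (2 \<in> B) (3 \<in> B)"
proof -
  have "{(a, b). a \<in> A \<and> b \<in> B \<and> b < a} =
      (if 2 \<in> A \<and> 1 \<in> B then {(2,1)} else {}) \<union> (if 3 \<in> A \<and> 1 \<in> B then {(3,1)} else {})
      \<union> (if 3 \<in> A \<and> 2 \<in> B then {(3,2)} else {})" (is "?S = ?T")
  proof (intro Set.set_eqI iffI)
    fix z assume "z \<in> ?S"
    then obtain a b where z: "z = (a, b)" "a \<in> A" "b \<in> B" "b < a" by auto
    then have "a \<in> {1, 2, 3}" "b \<in> {1, 2, 3}" using assms unfolding atLeastAtMost_1_3 by blast+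
    with z have "a = 2 \<and> b = 1 \<or> a = 3 \<and> b = 1 \<or> a = 3 \<and> b = 2" by auto
    with z show "z \<in> ?T" by (elim disjE) simp_all
  next
    fix z assume "z \<in> ?T"
    then show "z \<in> ?S" by (auto split: if_splits)
  qed
  then have 1: "card {(a, b). a \<in> A \<and> b \<in> B \<and> b < a} =
      of_bool (2 \<in> A \<and> 1 \<in> B) + of_bool (3 \<in> A \<and> 1 \<in> B) + of_bool (3 \<in> A \<and> 2 \<in> B)"
    by simp
  have "A \<inter> B = (if 1 \<in> A \<and> 1 \<in> B then {1} else {}) \<union> (if 2 \<in> A \<and> 2 \<in> B then {2} else {})
      \<union> (if 3 \<in> A \<and> 3 \<in> B then {3} else {})"
    using assms unfolding atLeastAtMost_1_3 by auto
  then have 2: "card (A \<inter> B) = of_bool (1 \<in> A \<and> 1 \<in> B) + of_bool (2 \<in> A \<and> 2 \<in> B) + of_bool (3 \<in> A \<and> 3 \<in> B)"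
    by simp
  show ?thesis unfolding cl_sign_def sgn3_def 1 2 by (simp add: ac_simps)
qed

lemma cl_mult_3: "cl_mult 3 (mv3 f) (mv3 g) = mv3 (\<lambda>p q r.
    \<Sum>a\<in>UNIV. \<Sum>b\<in>UNIV. \<Sum>c\<in>UNIV. sgn3 a b c (a \<noteq> p) (b \<noteq> q) (c \<noteq> r) * f a b c * g (a \<noteq> p) (b \<noteq> q) (c \<noteq> r))"
  (is "?l = ?r")
proof
  fix C
  show "?l C = ?r C"
  proof (cases "C \<subseteq> {1..3}")
    case True
    have "?l C = (\<Sum>A\<in>Pow {1..3::nat}. sgn3 (1 \<in> A) (2 \<in> A) (3 \<in> A)
        ((1 \<in> A) \<noteq> (1 \<in> C)) ((2 \<in> A) \<noteq> (2 \<in> C)) ((3 \<in> A) \<noteq> (3 \<in> C)) * f (1 \<in> A) (2 \<in> A) (3 \<in> A) *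
        g ((1 \<in> A) \<noteq> (1 \<in> C)) ((2 \<in> A) \<noteq> (2 \<in> C)) ((3 \<in> A) \<noteq> (3 \<in> C)))"
      using True unfolding cl_mult_eq
    proof (simp only: if_True, intro sum.cong refl)
      fix A :: "nat set" assume A: "A \<in> Pow {1..3}"
      have S: "sym_diff A C \<subseteq> {1..3}" using A True by blast
      have m: "k \<in> sym_diff A C \<longleftrightarrow> (k \<in> A) \<noteq> (k \<in> C)" for k by blast
      from A have A': "A \<subseteq> {1..3}" by simp
      show "cl_sign A (sym_diff A C) * mv3 f A * mv3 g (sym_diff A C) =
        sgn3 (1 \<in> A) (2 \<in> A) (3 \<in> A) ((1 \<in> A) \<noteq> (1 \<in> C)) ((2 \<in> A) \<noteq> (2 \<in> C)) ((3 \<in> A) \<noteq> (3 \<in> C)) *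
        f (1 \<in> A) (2 \<in> A) (3 \<in> A) * g ((1 \<in> A) \<noteq> (1 \<in> C)) ((2 \<in> A) \<noteq> (2 \<in> C)) ((3 \<in> A) \<noteq> (3 \<in> C))"
        unfolding cl_sign_3[OF A' S] mv3_def m using A' S by simp
    qed
    also have "\<dots> = ?r C"
      using True unfolding mv3_def atLeastAtMost_1_3
      by (simp add: sum_Pow_insert UNIV_bool)
    finally show ?thesis .
  qed (simp add: cl_mult_eq mv3_def)
qed

lemma cl_mult_2: "cl_mult 2 (mv2 f) (mv2 g) = mv2 (\<lambda>p q.
    \<Sum>a\<in>UNIV. \<Sum>b\<in>UNIV. sgn3 a b False (a \<noteq> p) (b \<noteq> q) False * f a b * g (a \<noteq> p) (b \<noteq> q))"
  (is "?l = ?r")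
proof
  fix C
  show "?l C = ?r C"
  proof (cases "C \<subseteq> {1..2}")
    case True
    have "?l C = (\<Sum>A\<in>Pow {1..2::nat}. sgn3 (1 \<in> A) (2 \<in> A) False
        ((1 \<in> A) \<noteq> (1 \<in> C)) ((2 \<in> A) \<noteq> (2 \<in> C)) False * f (1 \<in> A) (2 \<in> A) *
        g ((1 \<in> A) \<noteq> (1 \<in> C)) ((2 \<in> A) \<noteq> (2 \<in> C)))"
      using True unfolding cl_mult_eq
    proof (simp only: if_True, intro sum.cong refl)
      fix A :: "nat set" assume A: "A \<in> Pow {1..2}"
      have S: "sym_diff A C \<subseteq> {1..2}" using A True by blast
      have m: "k \<in> sym_diff A C \<longleftrightarrow> (k \<in> A) \<noteq> (k \<in> C)" for k by blast
      from A have A': "A \<subseteq> {1..2}" by simp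
      have 3: "A \<subseteq> {1..3}" "sym_diff A C \<subseteq> {1..3}" using A' S by fastforce+
      have 4: "3 \<notin> A" "3 \<notin> C" using A' True by fastforce+
      show "cl_sign A (sym_diff A C) * mv2 f A * mv2 g (sym_diff A C) =
        sgn3 (1 \<in> A) (2 \<in> A) False ((1 \<in> A) \<noteq> (1 \<in> C)) ((2 \<in> A) \<noteq> (2 \<in> C)) False *
        f (1 \<in> A) (2 \<in> A) * g ((1 \<in> A) \<noteq> (1 \<in> C)) ((2 \<in> A) \<noteq> (2 \<in> C))"
        unfolding cl_sign_3[OF 3] mv2_def m using A' S 4 by simp
    qed
    also have "\<dots> = ?r C"
      using True unfolding mv2_def atLeastAtMost_1_2
      by (simp add: sum_Pow_insert UNIV_bool)
    finally show ?thesis .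
  qed (simp add: cl_mult_eq mv2_def)
qed

text \<open>The basis \<open>1, i, j, k\<close> corresponds to the blades \<open>1, e\<^sub>1e\<^sub>2, e\<^sub>2e\<^sub>3, e\<^sub>1e\<^sub>3\<close>;
  in particular \<open>i j = - k\<close>.\<close>
datatype quat = Q (q1: real) (qi: real) (qj: real) (qk: real)

instantiation quat :: ring_1
begin
definition "0 = Q 0 0 0 0"
definition "1 = Q 1 0 0 0"
definition "x + y = Q (q1 x + q1 y) (qi x + qi y) (qj x + qj y) (qk x + qk y)"
definition "x - y = Q (q1 x - q1 y) (qi x - qi y) (qj x - qj y) (qk x - qk y)"
definition "- x = Q (- q1 x) (- qi x) (- qj x) (- qk x)"
definition "x * y = Q
  (q1 x * q1 y - qi x * qi y - qj x * qj y - qk x * qk y)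
  (q1 x * qi y + qi x * q1 y - qj x * qk y + qk x * qj y)
  (q1 x * qj y + qj x * q1 y + qi x * qk y - qk x * qi y)
  (q1 x * qk y + qk x * q1 y - qi x * qj y + qj x * qi y)"
instance
  by standard
    (simp_all add: zero_quat_def one_quat_def plus_quat_def minus_quat_def uminus_quat_def times_quat_def algebra_simps)
end

lemmas quat_defs = zero_quat_def one_quat_def plus_quat_def minus_quat_def uminus_quat_def times_quat_def

definition qnorm :: "quat \<Rightarrow> real" where
  "qnorm x = (q1 x)\<^sup>2 + (qi x)\<^sup>2 + (qj x)\<^sup>2 + (qk x)\<^sup>2"

definition qcnj :: "quat \<Rightarrow> quat" where
  "qcnj x = Q (q1 x) (- qi x) (- qj x) (- qk x)"

lemma qnorm_mult: "qnorm (x * y) = qnorm x * qnorm y"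
  by (simp add: qnorm_def times_quat_def power2_eq_square algebra_simps)

lemma qnorm_qcnj: "qnorm (qcnj x) = qnorm x"
  by (simp add: qnorm_def qcnj_def)

lemma qcnj_mult: "qnorm x = 1 \<Longrightarrow> qcnj x * x = 1"
  by (simp add: qnorm_def qcnj_def quat_defs power2_eq_square algebra_simps)

definition mvq :: "quat \<Rightarrow> mv" where
  "mvq x = mv3 (\<lambda>p q r. if p then if q then if r then 0 else qi x else if r then qk x else 0
     else if q then if r then qj x else 0 else if r then 0 else q1 x)"

definition odd3 :: "real \<Rightarrow> real \<Rightarrow> real \<Rightarrow> real \<Rightarrow> mv" where
  "odd3 u1 u2 u3 t = mv3 (\<lambda>p q r. if p then if q then if r then t else 0 else if r then 0 else u1
     else if q then if r then 0 else u2 else if r then u3 else 0)"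

lemma mvq_mult: "cl_mult 3 (mvq x) (mvq y) = mvq (x * y)"
  unfolding mvq_def cl_mult_3
  by (rule arg_cong[of _ _ mv3], intro ext)
     (auto simp add: UNIV_bool sgn3_def times_quat_def)

lemma vec_even: "cl_mult 3 (odd3 u1 u2 u3 0) (mvq (Q a b c d)) =
    odd3 (u1 * a + u2 * b + u3 * d) (u2 * a - u1 * b + u3 * c) (u3 * a - u2 * c - u1 * d) (u3 * b + u1 * c - u2 * d)"
  unfolding mvq_def odd3_def cl_mult_3
  by (rule arg_cong[of _ _ mv3], intro ext)
     (auto simp add: UNIV_bool sgn3_def)

lemma vec_odd: "cl_mult 3 (odd3 u1 u2 u3 0) (odd3 w1 w2 w3 t) =
    mvq (Q (- (u1 * w1 + u2 * w2 + u3 * w3)) (u1 * w2 - u2 * w1 - u3 * t)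
      (u2 * w3 - u3 * w2 - u1 * t) (u1 * w3 - u3 * w1 + u2 * t))"
  unfolding mvq_def odd3_def cl_mult_3
  by (rule arg_cong[of _ _ mv3], intro ext)
     (auto simp add: UNIV_bool sgn3_def)

lemma subset_1_3_cases:
  assumes "C \<subseteq> {1..3::nat}"
  obtains "C = {}" | "C = {1}" | "C = {2}" | "C = {3}" | "C = {1, 2}" | "C = {1, 3}" | "C = {2, 3}" | "C = {1, 2, 3}"
proof -
  have "C \<in> Pow {1, 2, 3}" using assms unfolding atLeastAtMost_1_3 by simp
  then show ?thesis using that by (simp add: Pow_insert) blast
qed

lemma cl_vec_3: "cl_vec 3 v = odd3 (v 1) (v 2) (v 3) 0"
proof
  fix C
  show "cl_vec 3 v C = odd3 (v 1) (v 2) (v 3) 0 C"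
  proof (cases "C \<subseteq> {1..3}")
    case True
    then show ?thesis
      by (cases rule: subset_1_3_cases) (simp_all add: cl_vec_def odd3_def mv3_def)
  qed (simp add: cl_vec_def odd3_def mv3_def)
qed

lemma subset_1_3_eq_iff:
  assumes "C \<subseteq> {1..3::nat}"
  shows "C = {} \<longleftrightarrow> 1 \<notin> C \<and> 2 \<notin> C \<and> 3 \<notin> C"
    and "C = {1, 2} \<longleftrightarrow> 1 \<in> C \<and> 2 \<in> C \<and> 3 \<notin> C"
    and "C = {2, 3} \<longleftrightarrow> 1 \<notin> C \<and> 2 \<in> C \<and> 3 \<in> C"
  using assms unfolding atLeastAtMost_1_3 by (intro iffI; simp?; blast)+

lemma cl_ab_12: "cl_ab a b {1, 2} = mvq (Q a b 0 0)"
  and cl_ab_23: "cl_ab a b {2, 3} = mvq (Q a 0 b 0)"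
  and cl_one_mvq: "cl_one = mvq 1"
proof -
  have "cl_ab a b {1, 2} C = mvq (Q a b 0 0) C \<and> cl_ab a b {2, 3} C = mvq (Q a 0 b 0) C
      \<and> cl_one C = mvq 1 C" for C
  proof (cases "C \<subseteq> {1..3}")
    case True
    show ?thesis unfolding cl_ab_def mvq_def mv3_def cl_one_def one_quat_def subset_1_3_eq_iff[OF True]
      using True by (cases "1 \<in> C"; cases "2 \<in> C"; cases "3 \<in> C") simp_all
  next
    case False
    then have "C \<noteq> {}" "C \<noteq> {1, 2}" "C \<noteq> {2, 3}" by auto
    with False show ?thesis by (simp add: cl_ab_def mvq_def mv3_def cl_one_def)
  qed
  then show "cl_ab a b {1, 2} = mvq (Q a b 0 0)" "cl_ab a b {2, 3} = mvq (Q a 0 b 0)" "cl_one = mvq 1"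
    by auto
qed

definition of_mv :: "mv \<Rightarrow> quat" where
  "of_mv x = Q (x {}) (x {1, 2}) (x {2, 3}) (x {1, 3})"

lemma of_mv_mvq [simp]: "of_mv (mvq x) = x"
  by (cases x) (simp add: of_mv_def mvq_def mv3_def)

lemma sum_1_3: "(\<Sum>k = 1..3. f k) = f 1 + f 2 + f (3::nat)" for f :: "nat \<Rightarrow> real"
  unfolding atLeastAtMost_1_3 by simp

text \<open>Multiplication by a unit vector exchanges even and odd elements and preserves the sum of
  squares of the coefficients. Conversely every unit quaternion is a product of two unit vectors, as
  every rotation of 3-space is a product of two reflections.\<close>

lemma spin_3: "spin 3 = mvq ` {x. qnorm x = 1}"
proof (intro equalityI subsetI)
  fix x assume "x \<in> spin 3"
  then obtain vs where x: "x = foldr (cl_mult 3) (map (cl_vec 3) vs) cl_one"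
    and vs: "even (length vs)" "\<And>v. v \<in> set vs \<Longrightarrow> unit_vec 3 v" unfolding spin_def by blast
  have "\<exists>w1 w2 w3 t. w1\<^sup>2 + w2\<^sup>2 + w3\<^sup>2 + t\<^sup>2 = 1 \<and>
      foldr (cl_mult 3) (map (cl_vec 3) vs) cl_one =
        (if even (length vs) then mvq (Q w1 w2 w3 t) else odd3 w1 w2 w3 t)"
    using vs(2)
  proof (induction vs)
    case Nil
    show ?case by (rule exI[of _ 1], rule exI[of _ 0], rule exI[of _ 0], rule exI[of _ 0])
        (simp add: cl_one_mvq one_quat_def)
  next
    case (Cons v vs)
    then obtain w1 w2 w3 t where w: "w1\<^sup>2 + w2\<^sup>2 + w3\<^sup>2 + t\<^sup>2 = 1"
      "foldr (cl_mult 3) (map (cl_vec 3) vs) cl_one =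
        (if even (length vs) then mvq (Q w1 w2 w3 t) else odd3 w1 w2 w3 t)" by auto
    have "unit_vec 3 v" using Cons.prems by simp
    then have v: "(v 1)\<^sup>2 + (v 2)\<^sup>2 + (v 3)\<^sup>2 = 1" unfolding unit_vec_def sum_1_3 .
    show ?case
    proof (cases "even (length vs)")
      case True
      have "(v 1 * w1 + v 2 * w2 + v 3 * t)\<^sup>2 + (v 2 * w1 - v 1 * w2 + v 3 * w3)\<^sup>2
        + (v 3 * w1 - v 2 * w3 - v 1 * t)\<^sup>2 + (v 3 * w2 + v 1 * w3 - v 2 * t)\<^sup>2
        = ((v 1)\<^sup>2 + (v 2)\<^sup>2 + (v 3)\<^sup>2) * (w1\<^sup>2 + w2\<^sup>2 + w3\<^sup>2 + t\<^sup>2)"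
        by (simp add: power2_eq_square algebra_simps)
      also have "\<dots> = 1" by (simp only: v w(1))
      finally show ?thesis using True w(2) by (auto simp: cl_vec_3[of v] vec_even)
    next
      case False
      have "(- (v 1 * w1 + v 2 * w2 + v 3 * w3))\<^sup>2 + (v 1 * w2 - v 2 * w1 - v 3 * t)\<^sup>2
        + (v 2 * w3 - v 3 * w2 - v 1 * t)\<^sup>2 + (v 1 * w3 - v 3 * w1 + v 2 * t)\<^sup>2
        = ((v 1)\<^sup>2 + (v 2)\<^sup>2 + (v 3)\<^sup>2) * (w1\<^sup>2 + w2\<^sup>2 + w3\<^sup>2 + t\<^sup>2)"
        by (simp add: power2_eq_square algebra_simps)
      also have "\<dots> = 1" by (simp only: v w(1))
      finally show ?thesis using False w(2) by (auto simp: cl_vec_3[of v] vec_odd)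
    qed
  qed
  then show "x \<in> mvq ` {x. qnorm x = 1}" using vs(1) unfolding x by (force simp: qnorm_def)
next
  fix x assume "x \<in> mvq ` {x. qnorm x = 1}"
  then obtain a b c d where x: "x = mvq (Q a b c d)" and 1: "a\<^sup>2 + b\<^sup>2 + c\<^sup>2 + d\<^sup>2 = 1"
    by (metis (mono_tags, lifting) imageE mem_Collect_eq qnorm_def quat.exhaust quat.sel)
  \<comment> \<open>A unit vector \<open>u = u\<^sub>1e\<^sub>1 + u\<^sub>2e\<^sub>2\<close> in the plane of the bivector part: then \<open>w = -u x\<close> is again a vector.\<close>
  obtain u1 u2 where u: "u1\<^sup>2 + u2\<^sup>2 = 1" "u1 * c = u2 * d"
  proof (cases "c = 0 \<and> d = 0")
    case True
    then show ?thesis using that[of 1 0] by simp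
  next
    case False
    define r where "r = sqrt (c\<^sup>2 + d\<^sup>2)"
    have "c\<^sup>2 + d\<^sup>2 > 0" using False by (simp add: sum_power2_gt_zero_iff)
    then have "r > 0" "r\<^sup>2 = c\<^sup>2 + d\<^sup>2" by (auto simp: r_def)
    have "(d / r)\<^sup>2 + (c / r)\<^sup>2 = (c\<^sup>2 + d\<^sup>2) / r\<^sup>2"
      by (simp add: power_divide add_divide_distrib)
    also have "\<dots> = 1" using \<open>r > 0\<close> unfolding \<open>r\<^sup>2 = _\<close>[symmetric] by simp
    finally show ?thesis using that[of "d / r" "c / r"] by simp
  qed
  define w1 w2 w3 where w: "w1 = - a * u1 - b * u2" "w2 = - a * u2 + b * u1" "w3 = c * u2 + d * u1"
  have uu: "(u1 * u1 + u2 * u2) * z = z" for z using u(1) by (simp add: power2_eq_square)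
  have "w1\<^sup>2 + w2\<^sup>2 + w3\<^sup>2 = (u1 * u1 + u2 * u2) * (a\<^sup>2 + b\<^sup>2 + c\<^sup>2 + d\<^sup>2) - (u1 * c - u2 * d)\<^sup>2"
    unfolding w by (simp add: power2_eq_square algebra_simps)
  then have wn: "w1\<^sup>2 + w2\<^sup>2 + w3\<^sup>2 = 1" using u(2) uu[of 1] 1 by simp
  have "- (u1 * w1 + u2 * w2) = (u1 * u1 + u2 * u2) * a" "u1 * w2 - u2 * w1 = (u1 * u1 + u2 * u2) * b"
    unfolding w by (simp_all add: algebra_simps)
  moreover have "u2 * w3 = u2 * u2 * c + u1 * (u2 * d)" "u1 * w3 = u2 * (u1 * c) + u1 * u1 * d"
    unfolding w by (simp_all add: algebra_simps)
  then have "u2 * w3 = u2 * u2 * c + u1 * (u1 * c)" "u1 * w3 = u2 * (u2 * d) + u1 * u1 * d"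
    by (simp_all only: u(2))
  then have "u2 * w3 = (u1 * u1 + u2 * u2) * c" "u1 * w3 = (u1 * u1 + u2 * u2) * d"
    by (simp_all only: distrib_right mult.assoc add.commute)
  ultimately have eq: "- (u1 * w1 + u2 * w2) = a" "u1 * w2 - u2 * w1 = b" "u2 * w3 = c" "u1 * w3 = d"
    by (simp_all only: uu)
  define u where "u k = (if k = 1 then u1 else if k = 2 then u2 else 0)" for k :: nat
  define w where "w k = (if k = 1 then w1 else if k = 2 then w2 else w3)" for k :: nat
  have "x = foldr (cl_mult 3) (map (cl_vec 3) [u, w]) cl_one"
    unfolding x eq[symmetric]
    by (simp add: cl_vec_3 cl_one_mvq one_quat_def vec_even vec_odd u_def w_def)
  moreover have "unit_vec 3 u" "unit_vec 3 w"
    using wn \<open>u1\<^sup>2 + u2\<^sup>2 = 1\<close> unfolding unit_vec_def sum_1_3 u_def w_def by simp_all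
  ultimately show "x \<in> spin 3" unfolding spin_def by (auto intro!: exI[of _ "[u, w]"])
qed

section \<open>Spin(2), embedded in the coordinates of Spin(3)\<close>

lemma mv2_mv3: "mv2 f = mv3 (\<lambda>p q r. if r then 0 else f p q)"
proof
  fix C :: "nat set"
  have "C \<subseteq> {1..2::nat} \<longleftrightarrow> C \<subseteq> {1..3} \<and> 3 \<notin> C"
    unfolding atLeastAtMost_1_3 atLeastAtMost_1_2 by auto
  then show "mv2 f C = mv3 (\<lambda>p q r. if r then 0 else f p q) C" by (simp add: mv2_def mv3_def)
qed

definition even2 :: "real \<Rightarrow> real \<Rightarrow> mv" where
  "even2 a b = mv2 (\<lambda>p q. if p then if q then b else 0 else if q then 0 else a)"

definition odd2 :: "real \<Rightarrow> real \<Rightarrow> mv" where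
  "odd2 a b = mv2 (\<lambda>p q. if p then if q then 0 else a else if q then b else 0)"

lemma even2_mvq: "even2 a b = mvq (Q a b 0 0)"
  unfolding even2_def mv2_mv3 mvq_def by (rule arg_cong[of _ _ mv3], intro ext) simp

lemma even2_mult: "cl_mult 2 (even2 a b) (even2 a' b') = even2 (a * a' - b * b') (a * b' + b * a')"
  unfolding even2_def cl_mult_2
  by (rule arg_cong[of _ _ mv2], intro ext) (auto simp add: UNIV_bool sgn3_def)

lemma vec_even2: "cl_mult 2 (odd2 u1 u2) (even2 a b) = odd2 (u1 * a + u2 * b) (u2 * a - u1 * b)"
  unfolding even2_def odd2_def cl_mult_2
  by (rule arg_cong[of _ _ mv2], intro ext) (auto simp add: UNIV_bool sgn3_def)

lemma vec_odd2: "cl_mult 2 (odd2 u1 u2) (odd2 w1 w2) = even2 (- (u1 * w1 + u2 * w2)) (u1 * w2 - u2 * w1)"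
  unfolding even2_def odd2_def cl_mult_2
  by (rule arg_cong[of _ _ mv2], intro ext) (auto simp add: UNIV_bool sgn3_def)

lemma cl_vec_2: "cl_vec 2 v = odd2 (v 1) (v 2)"
proof
  fix C
  have "cl_vec 2 v C = (if C \<subseteq> {1..2} then cl_vec 3 v C else 0)"
    unfolding cl_vec_def atLeastAtMost_1_3 atLeastAtMost_1_2 by auto
  also have "\<dots> = odd2 (v 1) (v 2) C"
    unfolding cl_vec_3 odd3_def odd2_def mv3_def mv2_def atLeastAtMost_1_3 atLeastAtMost_1_2 by auto
  finally show "cl_vec 2 v C = odd2 (v 1) (v 2) C" .
qed

lemma spin_2: "spin 2 = {even2 a b | a b. a\<^sup>2 + b\<^sup>2 = 1}"
proof (intro equalityI subsetI)
  fix x assume "x \<in> spin 2"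
  then obtain vs where x: "x = foldr (cl_mult 2) (map (cl_vec 2) vs) cl_one"
    and vs: "even (length vs)" "\<And>v. v \<in> set vs \<Longrightarrow> unit_vec 2 v" unfolding spin_def by blast
  have "\<exists>w1 w2. w1\<^sup>2 + w2\<^sup>2 = 1 \<and>
      foldr (cl_mult 2) (map (cl_vec 2) vs) cl_one =
        (if even (length vs) then even2 w1 w2 else odd2 w1 w2)"
    using vs(2)
  proof (induction vs)
    case Nil
    show ?case by (rule exI[of _ 1], rule exI[of _ 0])
        (simp add: cl_one_mvq one_quat_def even2_mvq)
  next
    case (Cons v vs)
    then obtain w1 w2 where w: "w1\<^sup>2 + w2\<^sup>2 = 1"
      "foldr (cl_mult 2) (map (cl_vec 2) vs) cl_one =
        (if even (length vs) then even2 w1 w2 else odd2 w1 w2)" by auto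
    have "unit_vec 2 v" using Cons.prems by simp
    then have v: "(v 1)\<^sup>2 + (v 2)\<^sup>2 = 1" unfolding unit_vec_def atLeastAtMost_1_2 by simp
    show ?case
    proof (cases "even (length vs)")
      case True
      have "(v 1 * w1 + v 2 * w2)\<^sup>2 + (v 2 * w1 - v 1 * w2)\<^sup>2 = ((v 1)\<^sup>2 + (v 2)\<^sup>2) * (w1\<^sup>2 + w2\<^sup>2)"
        by (simp add: power2_eq_square algebra_simps)
      also have "\<dots> = 1" by (simp only: v w(1))
      finally show ?thesis using True w(2) by (auto simp: cl_vec_2[of v] vec_even2)
    next
      case False
      have "(- (v 1 * w1 + v 2 * w2))\<^sup>2 + (v 1 * w2 - v 2 * w1)\<^sup>2 = ((v 1)\<^sup>2 + (v 2)\<^sup>2) * (w1\<^sup>2 + w2\<^sup>2)"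
        by (simp add: power2_eq_square algebra_simps)
      also have "\<dots> = 1" by (simp only: v w(1))
      finally show ?thesis using False w(2) by (auto simp: cl_vec_2[of v] vec_odd2)
    qed
  qed
  then show "x \<in> {even2 a b | a b. a\<^sup>2 + b\<^sup>2 = 1}" using vs(1) unfolding x by auto
next
  fix x assume "x \<in> {even2 a b | a b. a\<^sup>2 + b\<^sup>2 = 1}"
  then obtain a b where x: "x = even2 a b" and 1: "a\<^sup>2 + b\<^sup>2 = 1" by auto
  \<comment> \<open>e_1 (-a e_1 + b e_2) = a + b e_1 e_2.\<close>
  define u where "u k = (if k = 1 then 1 else 0::real)" for k :: nat
  define w where "w k = (if k = 1 then - a else b)" for k :: nat
  have "x = foldr (cl_mult 2) (map (cl_vec 2) [u, w]) cl_one"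
    unfolding x cl_one_mvq one_quat_def even2_mvq[symmetric] by (simp add: cl_vec_2 vec_even2 vec_odd2 u_def w_def)
  moreover have "unit_vec 2 u" "unit_vec 2 w"
    using 1 unfolding unit_vec_def atLeastAtMost_1_2 u_def w_def by simp_all
  ultimately show "x \<in> spin 2" unfolding spin_def by (auto intro!: exI[of _ "[u, w]"])
qed

section \<open>The defining relations in the enveloping group\<close>

locale spin_diagram = diagram +
  assumes two_le: "2 \<le> n"
begin

abbreviation amal_eq (infix "\<simeq>" 50) where "u \<simeq> v \<equiv> wcong (amal_rel n adj) u v"

abbreviation letters where "letters \<equiv> amal_letters n adj"

text \<open>The partner chosen in \<open>s_hat\<close>, so that \<open>s_hat\<close> unfolds to a
  translated letter.\<close>

definition other :: "nat \<Rightarrow> nat" where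
  "other i = (if i = 1 then 2 else 1)"

definition sl :: "nat \<Rightarrow> real \<Rightarrow> ((nat \<times> nat) \<times> mv \<times> mv) list" where
  "sl i t = [(pair i (other i), emb adj i (other i) (S_rot t))]"

definition ql :: "nat \<Rightarrow> nat \<Rightarrow> quat \<Rightarrow> ((nat \<times> nat) \<times> mv \<times> mv) list" where
  "ql i j x = [(pair i j, (mvq x, cl_one))]"

definition qemb :: "nat \<Rightarrow> nat \<Rightarrow> real \<Rightarrow> quat" where
  "qemb i j t = (if i < j then Q (cos t) (sin t) 0 0 else Q (cos t) 0 (sin t) 0)"

lemma other: "i \<in> {1..n} \<Longrightarrow> other i \<in> {1..n}" "other i \<noteq> i"
  using two_le by (auto simp: other_def)

lemma S_rot_even2: "S_rot t = even2 (cos t) (sin t)"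
  unfolding S_rot_def cl_ab_12 even2_mvq ..

lemma S_rot_spin: "S_rot t \<in> spin 2"
  unfolding S_rot_even2 spin_2 mem_Collect_eq
  by (rule exI[of _ "cos t"], rule exI[of _ "sin t"]) simp

lemma S_rot_mult: "cl_mult 2 (S_rot s) (S_rot t) = S_rot (s + t)"
  by (simp add: S_rot_even2 even2_mult cos_add sin_add algebra_simps)

lemma cl_one_S_rot: "cl_one = S_rot 0"
  by (simp add: S_rot_even2 even2_mvq cl_one_mvq one_quat_def)

lemma emb_adj: "adj i j \<Longrightarrow> emb adj i j (S_rot t) = (mvq (qemb i j t), cl_one)"
  by (simp add: emb_def S_rot_def qemb_def cl_ab_12 cl_ab_23)
     (simp add: cl_ab_def flip: cl_ab_12 cl_ab_23)

lemma qnorm_qemb: "qnorm (qemb i j t) = 1"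
  by (simp add: qnorm_def qemb_def)

lemma emb_nonadj: "\<not> adj i j \<Longrightarrow> emb adj i j x = (if i < j then (x, cl_one) else (cl_one, x))"
  by (simp add: emb_def)

lemma Gpair_pair:
  assumes "i \<in> {1..n}" "j \<in> {1..n}"
  shows "Gpair adj (pair i j) = (if adj i j then G_adj else G_nonadj)"
  using adj_sym[OF assms] by (auto simp: Gpair_def pair_def min_def max_def)

lemma pair_letter:
  assumes "i \<in> {1..n}" "j \<in> {1..n}" "i \<noteq> j"
  shows "(pair i j, g) \<in> letters \<longleftrightarrow> g \<in> carrier (if adj i j then G_adj else G_nonadj)"
  using assms Gpair_pair[OF assms(1,2)] by (auto simp: amal_letters_def pair_def min_def max_def)

lemma G_adj_carrier: "carrier G_adj = {(mvq x, cl_one) | x. qnorm x = 1}"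
  by (auto simp: G_adj_def spin_3)

lemma G_nonadj_carrier: "carrier G_nonadj = spin 2 \<times> spin 2"
  by (simp add: G_nonadj_def spin_grp_def)

lemma emb_letter:
  assumes "i \<in> {1..n}" "j \<in> {1..n}" "i \<noteq> j"
  shows "(pair i j, emb adj i j (S_rot t)) \<in> letters"
  using assms
  by (auto simp: pair_letter emb_adj emb_nonadj G_adj_carrier G_nonadj_carrier qnorm_qemb S_rot_spin
      cl_one_S_rot)

lemma amal_mult:
  assumes "(p, g) \<in> letters" "(p, h) \<in> letters"
  shows "[(p, g), (p, h)] \<simeq> [(p, g \<otimes>\<^bsub>Gpair adj p\<^esub> h)]"
  using assms unfolding amal_rel_def
  by (intro wcong_rel disjI1 exI[of _ p] exI[of _ g] exI[of _ h] conjI refl)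

lemma sl_via:
  assumes "i \<in> {1..n}" "j \<in> {1..n}" "i \<noteq> j"
  shows "sl i t \<simeq> [(pair i j, emb adj i j (S_rot t))]"
proof (cases "j = other i")
  case False
  then have "amal_rel n adj (sl i t) [(pair i j, emb adj i j (S_rot t))]"
    unfolding amal_rel_def sl_def
    using assms other[of i] S_rot_spin[of t] by metis
  then show ?thesis by (rule wcong_rel)
qed (simp add: sl_def wc_refl)

lemma ql_letter:
  assumes "i \<in> {1..n}" "j \<in> {1..n}" "i \<noteq> j" "adj i j" "qnorm x = 1"
  shows "(pair i j, (mvq x, cl_one)) \<in> letters"
  using assms by (auto simp: pair_letter G_adj_carrier)

lemma ql_mult:
  assumes "i \<in> {1..n}" "j \<in> {1..n}" "i \<noteq> j" "adj i j" "qnorm x = 1" "qnorm y = 1"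
  shows "ql i j x @ ql i j y \<simeq> ql i j (x * y)"
proof -
  have "(mvq x, cl_one) \<otimes>\<^bsub>Gpair adj (pair i j)\<^esub> (mvq y, cl_one) = (mvq (x * y), cl_one)"
    using assms by (simp add: Gpair_pair G_adj_def mvq_mult)
  then show ?thesis
    using amal_mult[OF ql_letter[OF assms(1-5)] ql_letter[OF assms(1-4,6)]] by (simp add: ql_def)
qed

lemma sl_ql:
  assumes "i \<in> {1..n}" "j \<in> {1..n}" "i \<noteq> j" "adj i j"
  shows "sl i t \<simeq> ql i j (qemb i j t)"
  using sl_via[OF assms(1-3)] assms(4) by (simp add: ql_def emb_adj)

lemma pair_commute: "pair i j = pair j i"
  by (simp add: pair_def min.commute max.commute)

lemma sl_ql':
  assumes "i \<in> {1..n}" "j \<in> {1..n}" "i \<noteq> j" "adj i j"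
  shows "sl j t \<simeq> ql i j (qemb j i t)"
  using sl_ql[of j i t] assms adj_sym by (simp add: ql_def pair_commute)

lemma sl_commute:
  assumes "i \<in> {1..n}" "j \<in> {1..n}" "i \<noteq> j" "\<not> adj i j"
  shows "sl i s @ sl j t \<simeq> sl j t @ sl i s"
proof -
  have nadj: "\<not> adj j i" using assms adj_sym by blast
  let ?p = "pair i j" and ?x = "emb adj i j (S_rot s)" and ?y = "emb adj j i (S_rot t)"
  have L: "(?p, ?x) \<in> letters" "(?p, ?y) \<in> letters"
    using emb_letter assms pair_commute[of i j] by metis+
  have "cl_mult 2 cl_one (S_rot t) = S_rot t" "cl_mult 2 (S_rot t) cl_one = S_rot t" for t
    by (simp_all add: cl_one_S_rot S_rot_mult)
  then have comm: "?x \<otimes>\<^bsub>Gpair adj ?p\<^esub> ?y = ?y \<otimes>\<^bsub>Gpair adj ?p\<^esub> ?x"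
    using assms nadj by (auto simp: Gpair_pair G_nonadj_def spin_grp_def emb_nonadj mult_DirProd')
  have 1: "sl i s \<simeq> [(?p, ?x)]" and 2: "sl j t \<simeq> [(?p, ?y)]"
    using sl_via[of i j s] sl_via[of j i t] assms pair_commute[of i j] by auto
  have "sl i s @ sl j t \<simeq> [(?p, ?x), (?p, ?y)]" using wcong_append[OF 1 2] by simp
  also have "\<dots> \<simeq> [(?p, ?y), (?p, ?x)]"
    by (rule wc_trans[OF amal_mult[OF L, unfolded comm] wc_sym[OF amal_mult[OF L(2,1)]]])
  also have "\<dots> \<simeq> sl j t @ sl i s" using wc_sym[OF wcong_append[OF 2 1]] by simp
  finally show ?thesis .
qed

lemma sl_add:
  assumes "i \<in> {1..n}"
  shows "sl i s @ sl i t \<simeq> sl i (s + t)"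
proof -
  let ?j = "other i"
  have ij: "?j \<in> {1..n}" "i \<noteq> ?j" using assms other[of i] by auto
  have L: "(pair i ?j, emb adj i ?j (S_rot t)) \<in> letters" for t using emb_letter assms ij by blast
  have "emb adj i ?j (S_rot s) \<otimes>\<^bsub>Gpair adj (pair i ?j)\<^esub> emb adj i ?j (S_rot t) = emb adj i ?j (S_rot (s + t))"
  proof (cases "adj i ?j")
    case True
    have "qemb i ?j s * qemb i ?j t = qemb i ?j (s + t)"
      by (simp add: qemb_def times_quat_def cos_add sin_add algebra_simps)
    then show ?thesis using True assms ij by (simp add: Gpair_pair G_adj_def mvq_mult emb_adj)
  next
    case False
    then show ?thesis using assms ij cl_one_S_rot S_rot_mult[of 0 0]
      by (simp add: Gpair_pair G_nonadj_def spin_grp_def emb_nonadj S_rot_mult)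
  qed
  then show ?thesis using amal_mult[OF L[of s] L[of t]] by (simp add: sl_def)
qed

lemma sl_0:
  assumes "i \<in> {1..n}"
  shows "sl i 0 \<simeq> []"
proof -
  let ?j = "other i"
  have ij: "?j \<in> {1..n}" "i \<noteq> ?j" using assms other[of i] by auto
  have "emb adj i ?j (S_rot 0) = \<one>\<^bsub>Gpair adj (pair i ?j)\<^esub>"
  proof (cases "adj i ?j")
    case True
    then show ?thesis using assms ij
      by (simp add: Gpair_pair G_adj_def emb_adj cl_one_mvq one_quat_def qemb_def)
  next
    case False
    then show ?thesis using assms ij
      by (simp add: Gpair_pair G_nonadj_def spin_grp_def emb_nonadj flip: cl_one_S_rot)
  qed
  then have "amal_rel n adj (sl i 0) []"
    using emb_letter[OF assms ij, of 0] unfolding amal_rel_def sl_def by metis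
  then show ?thesis by (rule wcong_rel)
qed

section \<open>Translation of words in the r_i, and the defining relations\<close>

definition tr :: "(nat \<times> bool) list \<Rightarrow> ((nat \<times> nat) \<times> mv \<times> mv) list" where
  "tr w = concat (map (\<lambda>(i, b). sl i (if b then pi / 4 else - pi / 4)) w)"

lemma tr_simps [simp]: "tr [] = []" "tr (u @ v) = tr u @ tr v"
  "tr ((i, b) # w) = sl i (if b then pi / 4 else - pi / 4) @ tr w"
  by (simp_all add: tr_def)

lemma tr_gen_pow: "i \<in> {1..n} \<Longrightarrow> tr (gen_pow i k) \<simeq> sl i (real k * pi / 4)"
proof (induction k)
  case 0
  then show ?case using sl_0 wc_sym by (simp add: gen_pow_def) blast
next
  case (Suc k)
  have "tr (gen_pow i (Suc k)) = sl i (pi / 4) @ tr (gen_pow i k)" by (simp add: gen_pow_def)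
  also have "\<dots> \<simeq> sl i (pi / 4) @ sl i (real k * pi / 4)" using Suc by (intro wcong_appendL) auto
  also have "\<dots> \<simeq> sl i (pi / 4 + real k * pi / 4)" using Suc.prems by (rule sl_add)
  finally show ?case by (simp add: field_simps)
qed

lemma ql_word3:
  assumes "i \<in> {1..n}" "j \<in> {1..n}" "i \<noteq> j" "adj i j" "qnorm x = 1" "qnorm y = 1" "qnorm z = 1"
    and "u \<simeq> ql i j x" "v \<simeq> ql i j y" "w \<simeq> ql i j z"
  shows "u @ v @ w \<simeq> ql i j (x * (y * z))"
proof -
  have vw: "v @ w \<simeq> ql i j (y * z)"
    using wcong_append[OF assms(9,10)] ql_mult[OF assms(1-4,6,7)] by (rule wc_trans)
  have "qnorm (y * z) = 1" by (simp add: qnorm_mult assms)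
  then show ?thesis
    by (rule wc_trans[OF wcong_append[OF assms(8) vw] ql_mult[OF assms(1-5)]])
qed

text \<open>For anticommuting x, y with square -1 one has (1 + x) y (1 + x) = y (1 - x)(1 + x) = 2
  y, hence (1 + x)(1 + y)(1 + x) = 2 x + 2 y, which is symmetric in x and y.\<close>

lemma tr_braid:
  assumes ij: "i \<in> {1..n}" "j \<in> {1..n}" "i \<noteq> j" "adj i j"
  shows "sl i (pi / 4) @ sl j (pi / 4) @ sl i (pi / 4) \<simeq> sl j (pi / 4) @ sl i (pi / 4) @ sl j (pi / 4)"
proof -
  let ?x = "qemb i j (pi / 4)" and ?y = "qemb j i (pi / 4)"
  have eq: "?x * (?y * ?x) = ?y * (?x * ?y)"
    using ij(3) by (auto simp: qemb_def times_quat_def cos_45 sin_45 algebra_simps)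
  have "sl i (pi / 4) @ sl j (pi / 4) @ sl i (pi / 4) \<simeq> ql i j (?x * (?y * ?x))"
    by (rule ql_word3[OF ij qnorm_qemb qnorm_qemb qnorm_qemb sl_ql[OF ij] sl_ql'[OF ij] sl_ql[OF ij]])
  also have "\<dots> \<simeq> sl j (pi / 4) @ sl i (pi / 4) @ sl j (pi / 4)"
    unfolding eq
    by (rule wc_sym[OF ql_word3[OF ij qnorm_qemb qnorm_qemb qnorm_qemb sl_ql'[OF ij] sl_ql[OF ij] sl_ql'[OF ij]]])
  finally show ?thesis .
qed

text \<open>For anticommuting x, y with square -1 one has (1 - x) y (1 + x) / 2 = y (1 + x)^2 / 2 =
  y x.\<close>

lemma tr_square_conj:
  assumes ij: "i \<in> {1..n}" "j \<in> {1..n}" "i \<noteq> j" "adj i j"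
  shows "sl i (- pi / 4) @ sl j (pi / 2) @ sl i (pi / 4) \<simeq> sl j (pi / 2) @ sl i (pi / 2)"
proof -
  let ?x = "qemb i j" and ?y = "qemb j i"
  have eq: "?x (- pi / 4) * (?y (pi / 2) * ?x (pi / 4)) = ?y (pi / 2) * ?x (pi / 2)"
    using ij(3) by (auto simp: qemb_def times_quat_def cos_45 sin_45 algebra_simps)
  have "sl i (- pi / 4) @ sl j (pi / 2) @ sl i (pi / 4) \<simeq> ql i j (?y (pi / 2) * ?x (pi / 2))"
    unfolding eq[symmetric]
    by (rule ql_word3[OF ij qnorm_qemb qnorm_qemb qnorm_qemb sl_ql[OF ij] sl_ql'[OF ij] sl_ql[OF ij]])
  also have "\<dots> \<simeq> sl j (pi / 2) @ sl i (pi / 2)"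
    by (rule wc_sym[OF wc_trans[OF wcong_append[OF sl_ql'[OF ij] sl_ql[OF ij]] ql_mult[OF ij qnorm_qemb qnorm_qemb]]])
  finally show ?thesis .
qed

lemma sl_cancel: "i \<in> {1..n} \<Longrightarrow> s + t = 0 \<Longrightarrow> sl i s @ sl i t \<simeq> []"
  using wc_trans[OF sl_add[of i s t]] sl_0 by simp

lemma alt_word_2_3: "alt_word i j 2 = [(i, True), (j, True)]"
    "alt_word i j 3 = [(i, True), (j, True), (i, True)]"
  by (simp_all add: alt_word_def numeral_eq_Suc)

lemma tr_rel:
  assumes "wspin_rel n adj u v"
  shows "tr u \<simeq> tr v"
  using assms unfolding wspin_rel_def
proof (elim disjE bexE exE conjE)
  fix i b assume "i \<in> {1..n}" "u = [(i, b), (i, \<not> b)]" "v = []"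
  then show ?thesis using sl_cancel by simp
next
  fix i assume i: "i \<in> {1..n}" "u = gen_pow i 8" "v = []"
  have "S_rot (2 * pi) = S_rot 0" by (simp add: S_rot_def)
  then have "sl i (real 8 * pi / 4) = sl i 0" by (simp add: sl_def)
  then show ?thesis using tr_gen_pow[OF i(1), of 8] sl_0[OF i(1)] i(2,3) by (auto intro: wc_trans)
next
  fix i j assume ij: "i \<in> {1..n}" "j \<in> {1..n}" "i \<noteq> j"
    and u: "u = [(i, False)] @ gen_pow j 2 @ [(i, True)]"
    and v: "v = gen_pow j 2 @ gen_pow i (2 * n_coef adj i j)"
  have 1: "tr u \<simeq> sl i (- pi / 4) @ sl j (pi / 2) @ sl i (pi / 4)"
    using wcong_subst[OF tr_gen_pow[OF ij(2), of 2]] by (simp add: u)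
  have 2: "tr v \<simeq> sl j (pi / 2) @ sl i (real (n_coef adj i j) * pi / 2)"
    using wcong_append[OF tr_gen_pow[OF ij(2), of 2] tr_gen_pow[OF ij(1), of "2 * n_coef adj i j"]]
    by (simp add: v mult.commute[of pi])
  have 3: "sl i (- pi / 4) @ sl j (pi / 2) @ sl i (pi / 4) \<simeq> sl j (pi / 2) @ sl i (real (n_coef adj i j) * pi / 2)"
  proof (cases "adj i j")
    case True
    then show ?thesis using tr_square_conj[OF ij True] by (simp add: n_coef_def)
  next
    case False
    have "sl i (- pi / 4) @ sl j (pi / 2) @ sl i (pi / 4) \<simeq> sl i (- pi / 4) @ sl i (pi / 4) @ sl j (pi / 2)"
      using wcong_appendL[OF sl_commute[of j i]] ij False adj_sym by blast
    also have "\<dots> \<simeq> sl j (pi / 2)"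
      using wcong_appendR[OF sl_cancel[OF ij(1), of "- pi / 4" "pi / 4"], of "sl j (pi / 2)"] by simp
    also have "\<dots> \<simeq> sl j (pi / 2) @ sl i 0"
      using wcong_appendL[OF wc_sym[OF sl_0[OF ij(1)]], of "sl j (pi / 2)"] by simp
    finally show ?thesis using False by (simp add: n_coef_def)
  qed
  show ?thesis by (rule wc_trans[OF 1 wc_trans[OF 3 wc_sym[OF 2]]])
next
  fix i j assume ij: "i \<in> {1..n}" "j \<in> {1..n}" "i \<noteq> j"
    and u: "u = alt_word i j (m_coef adj i j)"
    and v: "v = alt_word j i (m_coef adj i j)"
  show ?thesis
  proof (cases "adj i j")
    case True
    then show ?thesis using tr_braid[OF ij True] u v by (simp add: m_coef_def alt_word_2_3)
  next
    case False
    then show ?thesis using sl_commute[OF ij False] u v by (simp add: m_coef_def alt_word_2_3)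
  qed
qed

lemma tr_cong: "wcong (wspin_rel n adj) u v \<Longrightarrow> tr u \<simeq> tr v"
proof (induction rule: wcong.induct)
  case (wc_base u v x y)
  then show ?case using wcong_subst[OF tr_rel] by simp
next
  case (wc_trans u v w)
  then show ?case by (rule_tac wcong.wc_trans)
qed (simp_all add: wc_refl wc_sym)

text \<open>Letters are inverted by quaternion conjugation on edges, and by a + b e_1 e_2 going to a
  - b e_1 e_2 in each factor on non-edges.\<close>

lemma group_SpinPi: "group (SpinPi n adj)"
  unfolding SpinPi_def
proof (rule group_word_group)
  fix a assume "a \<in> letters"
  then obtain i j g where a: "a = ((i, j), g)" and ij: "i \<in> {1..n}" "j \<in> {1..n}" "i < j"
    and g: "g \<in> carrier (Gpair adj (i, j))" unfolding amal_letters_def by auto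
  have "\<exists>h \<in> carrier (Gpair adj (i, j)). h \<otimes>\<^bsub>Gpair adj (i, j)\<^esub> g = \<one>\<^bsub>Gpair adj (i, j)\<^esub>
      \<and> \<one>\<^bsub>Gpair adj (i, j)\<^esub> \<in> carrier (Gpair adj (i, j))"
  proof (cases "adj i j")
    case True
    then have G: "Gpair adj (i, j) = G_adj" by (simp add: Gpair_def)
    obtain x where x: "g = (mvq x, cl_one)" "qnorm x = 1" using g unfolding G G_adj_carrier by auto
    have "qnorm 1 = 1" by (simp add: qnorm_def one_quat_def)
    with x show ?thesis unfolding G G_adj_carrier
      by (intro bexI[of _ "(mvq (qcnj x), cl_one)"])
         (auto simp: G_adj_def mvq_mult qcnj_mult qnorm_qcnj cl_one_mvq)
  next
    case False
    then have G: "Gpair adj (i, j) = G_nonadj" by (simp add: Gpair_def)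
    have inv: "\<exists>y\<in>spin 2. cl_mult 2 y x = cl_one" if x: "x \<in> spin 2" for x
    proof -
      obtain a b where ab: "x = even2 a b" "a\<^sup>2 + b\<^sup>2 = 1" using x unfolding spin_2 by auto
      then have "even2 a (- b) \<in> spin 2" unfolding spin_2 by force
      moreover have "cl_mult 2 (even2 a (- b)) x = cl_one"
        using ab by (simp add: even2_mult cl_one_S_rot S_rot_even2 power2_eq_square)
      ultimately show ?thesis by blast
    qed
    obtain x y where xy: "g = (x, y)" "x \<in> spin 2" "y \<in> spin 2" using g unfolding G G_nonadj_carrier by auto
    obtain x' y' where "x' \<in> spin 2" "cl_mult 2 x' x = cl_one" "y' \<in> spin 2" "cl_mult 2 y' y = cl_one"
      using inv[OF xy(2)] inv[OF xy(3)] by blast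
    with xy show ?thesis unfolding G G_nonadj_carrier
      by (intro bexI[of _ "(x', y')"]) (auto simp: G_nonadj_def spin_grp_def cl_one_S_rot S_rot_spin)
  qed
  then obtain h where h: "h \<in> carrier (Gpair adj (i, j))"
    "h \<otimes>\<^bsub>Gpair adj (i, j)\<^esub> g = \<one>\<^bsub>Gpair adj (i, j)\<^esub>"
    and one: "\<one>\<^bsub>Gpair adj (i, j)\<^esub> \<in> carrier (Gpair adj (i, j))" by blast
  have "((i, j), h) \<in> letters" "((i, j), \<one>\<^bsub>Gpair adj (i, j)\<^esub>) \<in> letters"
    using ij h one by (auto simp: amal_letters_def)
  moreover from this(2) have "[((i, j), \<one>\<^bsub>Gpair adj (i, j)\<^esub>)] \<simeq> []"
    unfolding amal_rel_def by (intro wcong_rel) blast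
  then have "[((i, j), h), a] \<simeq> []"
    using amal_mult[of "(i, j)" h g] \<open>a \<in> letters\<close> calculation(1) unfolding a h(2) by (blast intro: wc_trans)
  ultimately show "\<exists>b\<in>letters. [b, a] \<simeq> []" by blast
qed

end

section \<open>The spin 3/2 representation\<close>

type_synonym spinor = "nat set \<Rightarrow> real"

definition linop :: "(spinor \<Rightarrow> spinor) \<Rightarrow> bool" where
  "linop F \<longleftrightarrow> (\<forall>s t. F (\<lambda>A. s A + t A) = (\<lambda>A. F s A + F t A)) \<and> (\<forall>c s. F (\<lambda>A. c * s A) = (\<lambda>A. c * F s A))"

lemma linop_add: "linop F \<Longrightarrow> F (\<lambda>A. s A + t A) A = F s A + F t A"
  and linop_scale: "linop F \<Longrightarrow> F (\<lambda>A. c * s A) A = c * F s A"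
  by (simp_all add: linop_def)

lemma linop_zero: "linop F \<Longrightarrow> F (\<lambda>A. 0) A = 0"
  using linop_scale[of F 0 "\<lambda>_. 0" A] by simp

lemma linop_sum: "linop F \<Longrightarrow> F (\<lambda>A. \<Sum>k\<in>K. s k A) A = (\<Sum>k\<in>K. F (s k) A)"
proof (induction K rule: infinite_finite_induct)
  case (insert x K)
  then show ?case using linop_add[OF insert.prems, of "s x" "\<lambda>A. \<Sum>k\<in>K. s k A" A] by simp
qed (simp_all add: linop_zero)

context diagram
begin

text \<open>A spinor is a coefficient function on monomials \<open>g\<^sub>A\<close> in generators with
  \<open>g\<^sub>i g\<^sub>i = -1\<close>, where \<open>g\<^sub>i\<close> and \<open>g\<^sub>j\<close> anticommute iff \<open>i\<close> and \<open>j\<close> are adjacent; \<open>gam i\<close> is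
  left multiplication by \<open>g\<^sub>i\<close>, with sign from moving \<open>g\<^sub>i\<close> past the smaller indices.\<close>
definition below :: "nat \<Rightarrow> nat set" where
  "below i = insert i {a. a < i \<and> adj i a}"

definition gsgn :: "nat \<Rightarrow> nat set \<Rightarrow> real" where
  "gsgn i B = (\<Prod>a\<in>below i. if a \<in> B then -1 else 1)"

definition gam :: "nat \<Rightarrow> spinor \<Rightarrow> spinor" where
  "gam i s = (\<lambda>A. gsgn i (sym_diff A {i}) * s (sym_diff A {i}))"

text \<open>As \<open>below i\<close> contains i itself, toggling i flips the sign; this is what
  makes g_i^2 = -1.\<close>

lemma gsgn_toggle:
  "gsgn i (sym_diff B {j}) = (if j \<in> below i then - gsgn i B else gsgn i B)"
proof (cases "j \<in> below i")
  case True
  have fin: "finite (below i)" by (simp add: below_def)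
  have "(\<Prod>a\<in>below i - {j}. if a \<in> sym_diff B {j} then -1 else 1) = (\<Prod>a\<in>below i - {j}. if a \<in> B then -1 else 1::real)"
    by (intro prod.cong) auto
  then show ?thesis unfolding gsgn_def prod.remove[OF fin True] using True by simp
next
  case False
  then have "(\<Prod>a\<in>below i. if a \<in> sym_diff B {j} then -1 else 1) = (\<Prod>a\<in>below i. if a \<in> B then -1 else 1::real)"
    by (intro prod.cong) auto
  with False show ?thesis by (simp add: gsgn_def)
qed

lemma gsgn_sq: "gsgn i B * gsgn i B = 1"
  unfolding gsgn_def prod.distrib[symmetric] by (intro prod.neutral) auto

lemma gsgn_sq': "gsgn i B * (gsgn i B * z) = z"
  by (simp add: gsgn_sq flip: mult.assoc)

lemma self_below: "i \<in> below i"
  by (simp add: below_def)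

lemma linop_gam: "linop (gam i)"
  by (simp add: linop_def gam_def algebra_simps)

lemma gam_gam: "gam i (gam i s) = (\<lambda>A. - s A)"
proof
  fix A
  have "sym_diff (sym_diff A {i}) {i} = A" by blast
  then show "gam i (gam i s) A = - s A"
    by (simp add: gam_def gsgn_toggle self_below gsgn_sq')
qed

lemma gam_gam_eq:
  assumes "i \<noteq> j"
  shows "gam i (gam j s) A = (if i \<in> below j then -1 else 1) * gsgn i A * gsgn j A * s (sym_diff (sym_diff A {i}) {j})"
  unfolding gam_def gsgn_toggle by (simp add: self_below)

text \<open>For adjacent i and j exactly one of \<open>i \<in> below j\<close> and
  \<open>j \<in> below i\<close> holds (the smaller index lies below the larger one), for
  non-adjacent ones neither does.\<close>

lemma gam_swap:
  assumes "i \<in> {1..n}" "j \<in> {1..n}" "i \<noteq> j"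
  shows "gam i (gam j s) = (\<lambda>A. (if adj i j then -1 else 1) * gam j (gam i s) A)"
proof
  fix A
  have "sym_diff (sym_diff A {i}) {j} = sym_diff (sym_diff A {j}) {i}" by blast
  moreover have "(if i \<in> below j then -1 else 1) = (if adj i j then -1 else 1) * (if j \<in> below i then -1 else 1::real)"
    using assms adj_sym[OF assms(1,2)] by (auto simp: below_def)
  ultimately show "gam i (gam j s) A = (if adj i j then -1 else 1) * gam j (gam i s) A"
    using assms(3) by (simp add: gam_gam_eq)
qed

definition cart :: "nat \<Rightarrow> (nat \<Rightarrow> spinor) \<Rightarrow> spinor" where
  "cart i \<phi> = (\<lambda>A. cartan n adj i (\<lambda>k. \<phi> k A))"

text \<open>\<open>cart\<close> is a functional on the factor V, F an operator on the factor S, and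
  these commute.\<close>

lemma cart_linop: "linop F \<Longrightarrow> cart i (\<lambda>k. F (\<phi> k)) = F (cart i \<phi>)"
proof
  fix A assume F: "linop F"
  let ?K = "{l \<in> {1..n}. adj i l}"
  have "cart i \<phi> = (\<lambda>A. 2 * \<phi> i A + (-1) * (\<Sum>l\<in>?K. \<phi> l A))"
    by (simp add: cart_def cartan_def)
  then have "F (cart i \<phi>) A = 2 * F (\<phi> i) A + (-1) * (\<Sum>l\<in>?K. F (\<phi> l) A)"
    by (simp only: linop_add[OF F] linop_scale[OF F] linop_sum[OF F])
  then show "cart i (\<lambda>k. F (\<phi> k)) A = F (cart i \<phi>) A"
    by (simp add: cart_def cartan_def)
qed

text \<open>A family \<open>\<phi>\<close> stands for \<open>\<Sum>\<^sub>k \<alpha>\<^sub>k \<otimes> \<phi>\<^sub>k\<close>. The index 0 is not a vertex, so the component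
  \<open>\<phi> 0\<close> carries the plain spin representation.\<close>
definition op1 :: "nat \<Rightarrow> (spinor \<Rightarrow> spinor) \<Rightarrow> (spinor \<Rightarrow> spinor) \<Rightarrow> (nat \<Rightarrow> spinor) \<Rightarrow> nat \<Rightarrow> spinor" where
  "op1 i X M \<phi> = (\<lambda>k A. X (\<phi> k) A + (if k = i then M (cart i \<phi>) A else 0))"

text \<open>The operator 1 (x) X plus the sum over a, b of alpha_a (alpha_b, .) (x)
  \<open>M a b\<close>, where the matrix indices 0 and 1 stand for the vertices i and j.\<close>

definition op2 :: "nat \<Rightarrow> nat \<Rightarrow> (spinor \<Rightarrow> spinor) \<Rightarrow> (nat \<Rightarrow> nat \<Rightarrow> spinor \<Rightarrow> spinor) \<Rightarrow> (nat \<Rightarrow> spinor) \<Rightarrow> nat \<Rightarrow> spinor" where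
  "op2 i j X M \<phi> = (\<lambda>k A. X (\<phi> k) A + (if k = i then M 0 0 (cart i \<phi>) A + M 0 1 (cart j \<phi>) A
      else if k = j then M 1 0 (cart i \<phi>) A + M 1 1 (cart j \<phi>) A else 0))"

lemma cart_upd2:
  assumes "i \<in> {1..n}" "j \<in> {1..n}" "i \<noteq> j" "linop X"
  shows "cart i (\<lambda>k A. X (\<phi> k) A + (if k = i then s A else if k = j then t A else 0)) A =
    X (cart i \<phi>) A + 2 * s A + (if adj i j then - t A else 0)"
proof -
  let ?v = "\<lambda>k. X (\<phi> k) A"
  have "(\<lambda>k. ?v k + (if k = i then s A else if k = j then t A else 0)) = ?v(j := ?v j + t A, i := ?v i + s A)"
    using assms(3) by auto
  then have "cart i (\<lambda>k A. X (\<phi> k) A + (if k = i then s A else if k = j then t A else 0)) A =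
     cart i (\<lambda>k. X (\<phi> k)) A + 2 * s A + (if adj i j then - t A else 0)"
    using assms by (simp add: cart_def cartan_upd adj_sym)
  then show ?thesis by (simp add: cart_linop[OF assms(4)])
qed

lemma cart_op1:
  assumes "i \<in> {1..n}" "linop X"
  shows "cart i (op1 i X M \<phi>) = (\<lambda>A. X (cart i \<phi>) A + 2 * M (cart i \<phi>) A)"
proof
  fix A
  let ?v = "\<lambda>k. X (\<phi> k) A"
  have "(\<lambda>k. op1 i X M \<phi> k A) = ?v(i := ?v i + M (cart i \<phi>) A)" by (auto simp: op1_def)
  then have "cart i (op1 i X M \<phi>) A = cart i (\<lambda>k. X (\<phi> k)) A + 2 * M (cart i \<phi>) A"
    using assms by (simp add: cart_def cartan_upd)
  then show "cart i (op1 i X M \<phi>) A = X (cart i \<phi>) A + 2 * M (cart i \<phi>) A"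
    by (simp add: cart_linop[OF assms(2)])
qed

lemma cart_op1_nonadj:
  assumes "i \<in> {1..n}" "j \<in> {1..n}" "i \<noteq> j" "\<not> adj i j" "linop X"
  shows "cart i (op1 j X M \<phi>) = X (cart i \<phi>)"
proof
  fix A
  let ?v = "\<lambda>k. X (\<phi> k) A"
  have "(\<lambda>k. op1 j X M \<phi> k A) = ?v(j := ?v j + M (cart j \<phi>) A)" by (auto simp: op1_def)
  then have "cart i (op1 j X M \<phi>) A = cart i (\<lambda>k. X (\<phi> k)) A"
    using assms adj_sym[OF assms(1,2)] by (simp add: cart_def cartan_upd)
  then show "cart i (op1 j X M \<phi>) A = X (cart i \<phi>) A"
    by (simp add: cart_linop[OF assms(5)])
qed

lemma cart_op2:
  assumes "i \<in> {1..n}" "j \<in> {1..n}" "i \<noteq> j" "adj i j" "linop X"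
  shows "cart i (op2 i j X M \<phi>) = (\<lambda>A. X (cart i \<phi>) A + 2 * (M 0 0 (cart i \<phi>) A + M 0 1 (cart j \<phi>) A)
      - (M 1 0 (cart i \<phi>) A + M 1 1 (cart j \<phi>) A))" (is ?A)
    and "cart j (op2 i j X M \<phi>) = (\<lambda>A. X (cart j \<phi>) A - (M 0 0 (cart i \<phi>) A + M 0 1 (cart j \<phi>) A)
      + 2 * (M 1 0 (cart i \<phi>) A + M 1 1 (cart j \<phi>) A))" (is ?B)
proof -
  show ?A unfolding op2_def
    using cart_upd2[OF assms(1-3,5)] assms(4) by (auto simp: fun_eq_iff)
  have *: "op2 i j X M \<phi> = (\<lambda>k A. X (\<phi> k) A + (if k = j then M 1 0 (cart i \<phi>) A + M 1 1 (cart j \<phi>) A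
      else if k = i then M 0 0 (cart i \<phi>) A + M 0 1 (cart j \<phi>) A else 0))"
    using assms(3) by (auto simp: op2_def fun_eq_iff)
  have "adj j i" "j \<noteq> i" using assms adj_sym by auto
  then show ?B unfolding *
    using cart_upd2[OF assms(2,1) _ assms(5)] by (auto simp: fun_eq_iff)
qed

text \<open>The factor 2 is (alpha_i, alpha_i), from composing alpha_i (alpha_i, .) with
  itself.\<close>

lemma op1_comp:
  assumes "i \<in> {1..n}" "linop X" "linop M" "linop Y"
  shows "op1 i X M (op1 i Y N \<phi>) =
    op1 i (\<lambda>s. X (Y s)) (\<lambda>s A. X (N s) A + M (Y s) A + 2 * M (N s) A) \<phi>"
proof (intro ext)
  fix k A
  have "M (cart i (op1 i Y N \<phi>)) A = M (Y (cart i \<phi>)) A + 2 * M (N (cart i \<phi>)) A"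
    unfolding cart_op1[OF assms(1,4)] by (simp add: linop_add[OF assms(3)] linop_scale[OF assms(3)])
  moreover have "X (op1 i Y N \<phi> k) A = X (Y (\<phi> k)) A + (if k = i then X (N (cart i \<phi>)) A else 0)"
    unfolding op1_def by (simp add: linop_add[OF assms(2)] linop_zero[OF assms(2)])
  ultimately show "op1 i X M (op1 i Y N \<phi>) k A =
    op1 i (\<lambda>s. X (Y s)) (\<lambda>s A. X (N s) A + M (Y s) A + 2 * M (N s) A) \<phi> k A"
    by (subst (1 3) op1_def) simp
qed

lemma op1_nonadj:
  assumes "i \<in> {1..n}" "j \<in> {1..n}" "i \<noteq> j" "\<not> adj i j" "linop X" "linop Y"
  shows "op1 i X M (op1 j Y N \<phi>) k A = X (Y (\<phi> k)) A + (if k = j then X (N (cart j \<phi>)) A else 0)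
    + (if k = i then M (Y (cart i \<phi>)) A else 0)"
proof -
  have "X (op1 j Y N \<phi> k) A = X (Y (\<phi> k)) A + (if k = j then X (N (cart j \<phi>)) A else 0)"
    unfolding op1_def by (simp add: linop_add[OF assms(5)] linop_zero[OF assms(5)])
  then show ?thesis
    unfolding op1_def[of i X M] cart_op1_nonadj[OF assms(1-4,6)] by simp
qed

lemma op1_commute:
  assumes ij: "i \<in> {1..n}" "j \<in> {1..n}" "i \<noteq> j" "\<not> adj i j" and lin: "linop X" "linop Y"
    and comm: "\<And>s. X (Y s) = Y (X s)" "\<And>s. X (N s) = N (X s)" "\<And>s. M (Y s) = Y (M s)"
  shows "op1 i X M (op1 j Y N \<phi>) = op1 j Y N (op1 i X M \<phi>)"
proof -
  have "\<not> adj j i" using ij adj_sym by blast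
  then show ?thesis
    using ij by (intro ext) (simp add: op1_nonadj[OF ij lin] op1_nonadj[OF ij(2,1) _ _ lin(2,1)] comm)
qed

text \<open>Composing alpha_a (alpha_b, .) with alpha_c (alpha_d, .) produces the scalar (alpha_b,
  alpha_c), which is 2 for b = c and -1 otherwise.\<close>

lemma op2_comp:
  assumes ij: "i \<in> {1..n}" "j \<in> {1..n}" "i \<noteq> j" "adj i j"
    and lin: "linop X" "\<And>a b. linop (M a b)" "linop Y"
  shows "op2 i j X M (op2 i j Y N \<phi>) = op2 i j (\<lambda>s. X (Y s))
    (\<lambda>a b s A. X (N a b s) A + M a b (Y s) A + 2 * M a 0 (N 0 b s) A - M a 0 (N 1 b s) A
       - M a 1 (N 0 b s) A + 2 * M a 1 (N 1 b s) A) \<phi>"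
proof (intro ext)
  fix k A
  have neg: "M a b (\<lambda>A. s A - t A) A = M a b s A - M a b t A" for a b s t
    using linop_add[OF lin(2), of a b s "\<lambda>A. -1 * t A" A] linop_scale[OF lin(2), of a b "-1" t A] by simp
  note M = linop_add[OF lin(2)] linop_scale[OF lin(2)] neg
  let ?ci = "cart i \<phi>" and ?cj = "cart j \<phi>"
  have i: "M a 0 (cart i (op2 i j Y N \<phi>)) A = M a 0 (Y ?ci) A + 2 * (M a 0 (N 0 0 ?ci) A + M a 0 (N 0 1 ?cj) A)
     - (M a 0 (N 1 0 ?ci) A + M a 0 (N 1 1 ?cj) A)" for a
    unfolding cart_op2(1)[OF ij lin(3)] by (simp add: M)
  have j: "M a 1 (cart j (op2 i j Y N \<phi>)) A = M a 1 (Y ?cj) A - (M a 1 (N 0 0 ?ci) A + M a 1 (N 0 1 ?cj) A)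
     + 2 * (M a 1 (N 1 0 ?ci) A + M a 1 (N 1 1 ?cj) A)" for a
    unfolding cart_op2(2)[OF ij lin(3)] by (simp add: M)
  have "X (op2 i j Y N \<phi> k) A = X (Y (\<phi> k)) A + (if k = i then X (N 0 0 ?ci) A + X (N 0 1 ?cj) A
      else if k = j then X (N 1 0 ?ci) A + X (N 1 1 ?cj) A else 0)"
    unfolding op2_def by (simp add: linop_add[OF lin(1)] linop_zero[OF lin(1)])
  then show "op2 i j X M (op2 i j Y N \<phi>) k A = op2 i j (\<lambda>s. X (Y s))
    (\<lambda>a b s A. X (N a b s) A + M a b (Y s) A + 2 * M a 0 (N 0 b s) A - M a 0 (N 1 b s) A
       - M a 1 (N 0 b s) A + 2 * M a 1 (N 1 b s) A) \<phi> k A"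
    unfolding op2_def[of i j X M] op2_def[of i j "\<lambda>s. X (Y s)"] i j by simp
qed

end

section \<open>Quaternion matrices for the action of an edge\<close>

definition qr :: "real \<Rightarrow> quat" where
  "qr r = Q r 0 0 0"

definition qu :: "nat \<Rightarrow> quat" where
  "qu k = (if k = 0 then Q 0 0 1 0 else if k = 1 then Q 0 0 0 (-1) else Q 0 1 0 0)"

text \<open>\<open>qu k\<close> is \<open>e\<^sub>l e\<^sub>1e\<^sub>2e\<^sub>3\<close>, \<open>l = k + 1\<close>, up to a common sign, and \<open>rot\<close> is the rotation matrix of
  conjugation by a unit quaternion. Hence \<open>twist\<close> is the matrix of the vector-spinor representation
  \<open>rot \<otimes> x\<close> after the change of basis \<open>diag (qu 0, qu 1, qu 2)\<close>; in this basis the rows and columns of \<open>twist\<close> sum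
  to \<open>x\<close>, so \<open>twist - x\<close> lives on the simple_root lattice \<open>A\<^sub>2\<close> spanned by \<open>(1, -1, 0)\<close> and \<open>(0, 1, -1)\<close>.\<close>
definition rot :: "nat \<Rightarrow> nat \<Rightarrow> quat \<Rightarrow> real" where
  "rot k l x = - q1 (qcnj x * qu k * x * qu l)"

definition twist :: "nat \<Rightarrow> nat \<Rightarrow> quat \<Rightarrow> quat" where
  "twist k l x = - (qr (rot k l x) * qu k * x * qu l)"

lemma less_3_cases: "k < 3 \<Longrightarrow> k = 0 \<or> k = 1 \<or> k = (2::nat)" by auto

lemma qr_simps: "qr (a + b) = qr a + qr b" "qr (a * b) = qr a * qr b" "qr r * x = x * qr r"
  by (simp_all add: qr_def quat_defs)

lemma qu_sq: "qu k * qu k = -1"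
  by (simp add: qu_def quat_defs)

text \<open>Conjugation keeps imaginary quaternions imaginary, and \<open>- q1 (z * qu l)\<close>
  reads off the coordinate of such a z at \<open>qu l\<close>.\<close>

lemma rot_expand:
  assumes "k < 3"
  shows "qcnj x * qu k * x = qr (rot k 0 x) * qu 0 + qr (rot k 1 x) * qu 1 + qr (rot k 2 x) * qu 2"
  using less_3_cases[OF assms]
  by (elim disjE; hypsubst; cases x) (simp_all add: rot_def qr_def qu_def qcnj_def quat_defs algebra_simps)

lemma qcnj_times: "qcnj (x * y) = qcnj y * qcnj x"
  by (simp add: qcnj_def quat_defs algebra_simps)

lemma q1_simps: "q1 (x + y) = q1 x + q1 y" "q1 (qr r * x) = r * q1 x"
  by (simp_all add: qr_def quat_defs)

lemma qr_left: "z * (qr r * w) = qr r * (z * w)"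
  by (simp add: qr_simps(3) flip: mult.assoc) (simp add: qr_simps(3) mult.assoc)

lemma rot_mult:
  assumes "k < 3"
  shows "rot k m (x * y) = rot k 0 x * rot 0 m y + rot k 1 x * rot 1 m y + rot k 2 x * rot 2 m y"
proof -
  have "qcnj (x * y) * qu k * (x * y) * qu m = qcnj y * (qcnj x * qu k * x) * y * qu m"
    by (simp add: qcnj_times mult.assoc)
  also have "\<dots> = qr (rot k 0 x) * (qcnj y * qu 0 * y * qu m) + qr (rot k 1 x) * (qcnj y * qu 1 * y * qu m)
      + qr (rot k 2 x) * (qcnj y * qu 2 * y * qu m)"
    unfolding rot_expand[OF assms]
    by (simp only: distrib_left distrib_right mult.assoc qr_left)
  finally show ?thesis unfolding rot_def by (simp add: q1_simps algebra_simps)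
qed

lemma twist_twist: "twist k l x * twist l m y = - (qr (rot k l x * rot l m y) * qu k * (x * y) * qu m)"
proof -
  have "twist k l x * twist l m y = qr (rot k l x) * qu k * x * (qu l * qr (rot l m y) * qu l) * y * qu m"
    by (simp add: twist_def mult.assoc)
  also have "qu l * qr (rot l m y) * qu l = - qr (rot l m y)"
    using qu_sq[of l] qr_simps(3)[of "rot l m y" "qu l"] by (metis mult.assoc mult_minus1_right)
  also have "qr (rot k l x) * qu k * x * (- qr (rot l m y)) * y * qu m = - (qr (rot k l x) * (qr (rot l m y) * (qu k * x)) * y * qu m)"
    using qr_simps(3)[of "rot l m y" "qu k * x"] by (simp add: mult.assoc)
  finally show ?thesis by (simp add: qr_simps(2) mult.assoc)
qed

text \<open>In \<open>twist k l x * twist l m y\<close> the two inner factors \<open>qu l\<close>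
  cancel to -1, so the quaternion part is the same for every l and only the matrix product of the
  \<open>rot\<close> entries has to be summed.\<close>

lemma twist_mult:
  assumes "k < 3"
  shows "twist k m (x * y) = twist k 0 x * twist 0 m y + twist k 1 x * twist 1 m y + twist k 2 x * twist 2 m y"
  unfolding twist_twist twist_def[of k m] rot_mult[OF assms]
  by (simp add: qr_simps(1) distrib_right)

text \<open>Summing \<open>rot k l x * qu l\<close> over l gives \<open>qcnj x * qu k * x\<close>,
  so the row sum is \<open>- qu k * x * qcnj x * qu k * x\<close>, where \<open>x * qcnj x\<close>
  is the real number \<open>qnorm x\<close> and \<open>qu k\<close> squares to -1.\<close>

lemma twist_row:
  assumes "k < 3"
  shows "twist k 0 x + twist k 1 x + twist k 2 x = qr (qnorm x) * x"
  using less_3_cases[OF assms]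
  by (elim disjE; hypsubst; cases x)
     (simp_all add: twist_def rot_def qr_def qu_def qcnj_def qnorm_def quat_defs power2_eq_square algebra_simps)

text \<open>Dually, summing \<open>rot l k x * qu l\<close> over l gives
  \<open>x * qu k * qcnj x\<close>.\<close>

lemma twist_col:
  assumes "k < 3"
  shows "twist 0 k x + twist 1 k x + twist 2 k x = qr (qnorm x) * x"
  using less_3_cases[OF assms]
  by (elim disjE; hypsubst; cases x)
     (simp_all add: twist_def rot_def qr_def qu_def qcnj_def qnorm_def quat_defs power2_eq_square algebra_simps)

text \<open>The entries of \<open>twist - x\<close> relative to these two roots; the weights 2 and -1 in \<open>coef_mult\<close> are
  the Cartan matrix of \<open>A\<^sub>2\<close>.\<close>
definition coef :: "nat \<Rightarrow> nat \<Rightarrow> quat \<Rightarrow> quat" where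
  "coef a b x = (if a = b then twist (2 * a) (2 * b) x - x else - twist (2 * a) (2 * b) x)"

text \<open>This is \<open>twist_mult\<close> read in root coordinates, in exactly the shape
  produced by \<open>op2_comp\<close>. Coordinate 0 meets only the root (1, -1, 0) and coordinate 2
  only (0, 1, -1), so the four corner entries of the matrix carry all coefficients.\<close>

lemma coef_mult:
  assumes "qnorm x = 1" "qnorm y = 1" "a \<le> 1" "b \<le> 1"
  shows "coef a b (x * y) = x * coef a b y + coef a b x * y + (coef a 0 x * coef 0 b y + coef a 0 x * coef 0 b y)
    - coef a 0 x * coef 1 b y - coef a 1 x * coef 0 b y + (coef a 1 x * coef 1 b y + coef a 1 x * coef 1 b y)"
proof -
  have one: "qr 1 * z = z" for z by (simp add: qr_def quat_defs)
  \<comment> \<open>The middle row and column are eliminated by the row and column sums.\<close>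
  have r: "twist (2 * a) 1 x = x - twist (2 * a) 0 x - twist (2 * a) 2 x"
    using twist_row[of "2 * a" x] assms(1,3) by (simp add: one algebra_simps)
  have c: "twist 1 (2 * b) y = y - twist 0 (2 * b) y - twist 2 (2 * b) y"
    using twist_col[of "2 * b" y] assms(2,4) by (simp add: one algebra_simps)
  have m: "twist (2 * a) (2 * b) (x * y) = twist (2 * a) 0 x * twist 0 (2 * b) y
     + (x - twist (2 * a) 0 x - twist (2 * a) 2 x) * (y - twist 0 (2 * b) y - twist 2 (2 * b) y)
     + twist (2 * a) 2 x * twist 2 (2 * b) y"
    using twist_mult[of "2 * a" "2 * b" x y] assms(3) unfolding r c by simp
  have "a = 0 \<or> a = 1" "b = 0 \<or> b = 1" using assms(3,4) by auto
  then show ?thesis unfolding coef_def m by (elim disjE) (simp_all add: algebra_simps numeral_2_eq_2)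
qed

text \<open>For z = (cos t, sin t) this is ((cos 3t - cos t) / 2, -(sin 3t + sin t) / 2). Along
  alpha_i, where \<open>cart i\<close> is 2, \<open>z + 2 * mcoef z\<close> is then (cos 3t, -sin
  3t), the spin 3/2 part.\<close>

definition mcoef :: "real \<times> real \<Rightarrow> real \<times> real" where
  "mcoef z = (((fst z)\<^sup>2 - (snd z)\<^sup>2) * fst z - fst z, - (((fst z)\<^sup>2 - (snd z)\<^sup>2) * snd z) - snd z)"

text \<open>The circle of one vertex rotates a coordinate plane and fixes the third axis, so
  \<open>twist - x\<close> is supported on two coordinates with zero row and column sums: a multiple
  of the rank-one matrix of that vertex's root.\<close>

lemma coef_pure:
  assumes "a\<^sup>2 + b\<^sup>2 = 1"
  shows "coef 0 0 (Q a b 0 0) = Q (fst (mcoef (a, b))) (snd (mcoef (a, b))) 0 0"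
    "coef 0 1 (Q a b 0 0) = 0" "coef 1 0 (Q a b 0 0) = 0" "coef 1 1 (Q a b 0 0) = 0"
    "coef 1 1 (Q a 0 b 0) = Q (fst (mcoef (a, b))) 0 (snd (mcoef (a, b))) 0"
    "coef 0 1 (Q a 0 b 0) = 0" "coef 1 0 (Q a 0 b 0) = 0" "coef 0 0 (Q a 0 b 0) = 0"
proof -
  have b: "b * b = 1 - a * a" using assms by (simp add: power2_eq_square)
  have b': "b * (b * z) = z - a * (a * z)" for z
    unfolding mult.assoc[of b b z, symmetric] b by (simp add: algebra_simps)
  note defs = coef_def twist_def rot_def qr_def qu_def qcnj_def quat_defs mcoef_def power2_eq_square algebra_simps
  show "coef 0 0 (Q a b 0 0) = Q (fst (mcoef (a, b))) (snd (mcoef (a, b))) 0 0"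
    "coef 0 1 (Q a b 0 0) = 0" "coef 1 0 (Q a b 0 0) = 0" "coef 1 1 (Q a b 0 0) = 0"
    "coef 1 1 (Q a 0 b 0) = Q (fst (mcoef (a, b))) 0 (snd (mcoef (a, b))) 0"
    "coef 0 1 (Q a 0 b 0) = 0" "coef 1 0 (Q a 0 b 0) = 0" "coef 0 0 (Q a 0 b 0) = 0"
    by (simp_all add: defs b b')
qed

context diagram
begin

text \<open>The last sign is forced by the convention i j = - k: the unit k acts as -g_i
  g_j.\<close>

definition qact :: "nat \<Rightarrow> nat \<Rightarrow> quat \<Rightarrow> spinor \<Rightarrow> spinor" where
  "qact i j x s = (\<lambda>A. q1 x * s A + qi x * gam i s A + qj x * gam j s A - qk x * gam i (gam j s) A)"

definition cact :: "nat \<Rightarrow> real \<times> real \<Rightarrow> spinor \<Rightarrow> spinor" where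
  "cact i z s = (\<lambda>A. fst z * s A + snd z * gam i s A)"

lemma linop_qact: "linop (qact i j x)"
  using linop_gam[of i] linop_gam[of j] by (simp add: linop_def qact_def algebra_simps)

lemma linop_cact: "linop (cact i z)"
  using linop_gam[of i] by (simp add: linop_def cact_def algebra_simps)

lemma gam_comb: "gam i (\<lambda>A. a * s A + b * t A) = (\<lambda>A. a * gam i s A + b * gam i t A)"
  "gam i (\<lambda>A. a * s A + b * t A + c * u A - d * v A) = (\<lambda>A. a * gam i s A + b * gam i t A + c * gam i u A - d * gam i v A)"
  "gam i (\<lambda>A. - s A) = (\<lambda>A. - gam i s A)"
  by (simp_all add: gam_def algebra_simps)

lemma qact_mult:
  assumes "i \<in> {1..n}" "j \<in> {1..n}" "i \<noteq> j" "adj i j"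
  shows "qact i j x (qact i j y s) = qact i j (x * y) s"
proof -
  have sw: "gam j (gam i s) = (\<lambda>A. - gam i (gam j s) A)" for s
    using gam_swap[OF assms(2,1)] assms adj_sym by auto
  show ?thesis
    unfolding qact_def gam_comb gam_gam sw by (simp add: times_quat_def algebra_simps)
qed

lemma qact_add: "qact i j (x + y) s A = qact i j x s A + qact i j y s A"
  "qact i j (x - y) s A = qact i j x s A - qact i j y s A" "qact i j 0 s A = 0"
  by (simp_all add: qact_def quat_defs algebra_simps)

lemma cact_mult: "cact i (a, b) (cact i (a', b') s) = cact i (a * a' - b * b', a * b' + b * a') s"
  by (simp add: cact_def gam_comb gam_gam algebra_simps)

lemma cact_commute:
  assumes "i \<in> {1..n}" "j \<in> {1..n}" "i \<noteq> j" "\<not> adj i j"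
  shows "cact i z (cact j w s) = cact j w (cact i z s)"
  using gam_swap[OF assms(1-3)] assms(4) by (simp add: cact_def gam_comb algebra_simps)

definition rep1 :: "nat \<Rightarrow> real \<times> real \<Rightarrow> (nat \<Rightarrow> spinor) \<Rightarrow> nat \<Rightarrow> spinor" where
  "rep1 i z = op1 i (cact i z) (cact i (mcoef z))"

definition rep2 :: "nat \<Rightarrow> nat \<Rightarrow> quat \<Rightarrow> (nat \<Rightarrow> spinor) \<Rightarrow> nat \<Rightarrow> spinor" where
  "rep2 i j x = op2 i j (qact i j x) (\<lambda>a b. qact i j (coef a b x))"

lemma rep2_mult:
  assumes ij: "i \<in> {1..n}" "j \<in> {1..n}" "i \<noteq> j" "adj i j" and "qnorm x = 1" "qnorm y = 1"
  shows "rep2 i j x (rep2 i j y \<phi>) = rep2 i j (x * y) \<phi>"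
proof -
  have H: "qact i j (coef a b (x * y)) s A = qact i j x (qact i j (coef a b y) s) A + qact i j (coef a b x) (qact i j y s) A
      + 2 * qact i j (coef a 0 x) (qact i j (coef 0 b y) s) A - qact i j (coef a 0 x) (qact i j (coef 1 b y) s) A
      - qact i j (coef a 1 x) (qact i j (coef 0 b y) s) A + 2 * qact i j (coef a 1 x) (qact i j (coef 1 b y) s) A"
    if "a \<le> 1" "b \<le> 1" for a b s A
    unfolding coef_mult[OF assms(5,6) that] by (simp add: qact_add qact_mult[OF ij])
  show ?thesis
    unfolding rep2_def op2_comp[OF ij linop_qact linop_qact linop_qact]
    unfolding op2_def
    by (intro ext) (simp only: H le0 order_refl qact_mult[OF ij])
qed

text \<open>Together with \<open>rep2_j\<close> this is the compatibility of the edge action with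
  the vertex action, as the identifications in the amalgam demand.\<close>

lemma rep2_i:
  assumes "i \<noteq> j" "a\<^sup>2 + b\<^sup>2 = 1"
  shows "rep2 i j (Q a b 0 0) \<phi> = rep1 i (a, b) \<phi>"
  unfolding rep2_def rep1_def op1_def op2_def
  by (intro ext, simp only: coef_pure[OF assms(2)] qact_add) (simp add: qact_def cact_def)

lemma rep2_j:
  assumes "i \<noteq> j" "a\<^sup>2 + b\<^sup>2 = 1"
  shows "rep2 i j (Q a 0 b 0) \<phi> = rep1 j (a, b) \<phi>"
  unfolding rep2_def rep1_def op1_def op2_def using assms(1)
  by (intro ext, simp only: coef_pure[OF assms(2)] qact_add) (simp add: qact_def cact_def)

lemma rep1_one: "rep1 i (1, 0) \<phi> = \<phi>"
  by (intro ext) (simp add: rep1_def op1_def cact_def mcoef_def)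

text \<open>The multiplication law of \<open>mcoef\<close> is the entry (0, 0) of
  \<open>coef_mult\<close> on the circle \<open>Q a b 0 0\<close>. It is a pure identity of
  coefficients, so it also serves vertices without neighbours.\<close>

lemma rep1_mult:
  assumes "i \<in> {1..n}" "a\<^sup>2 + b\<^sup>2 = 1" "c\<^sup>2 + d\<^sup>2 = 1"
  shows "rep1 i (a, b) (rep1 i (c, d) \<phi>) = rep1 i (a * c - b * d, a * d + b * c) \<phi>"
proof -
  let ?x = "Q a b 0 0" and ?y = "Q c d 0 0"
  have xy: "?x * ?y = Q (a * c - b * d) (a * d + b * c) 0 0" by (simp add: times_quat_def)
  have nx: "qnorm ?x = 1" "qnorm ?y = 1" using assms by (simp_all add: qnorm_def)
  have "(a * c - b * d)\<^sup>2 + (a * d + b * c)\<^sup>2 = (a\<^sup>2 + b\<^sup>2) * (c\<^sup>2 + d\<^sup>2)"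
    by (simp add: power2_eq_square algebra_simps)
  then have nxy: "(a * c - b * d)\<^sup>2 + (a * d + b * c)\<^sup>2 = 1" using assms by simp
  let ?z = "(a * c - b * d, a * d + b * c)"
  have m: "mcoef ?z = (fst (mcoef (c, d)) * a - snd (mcoef (c, d)) * b + fst (mcoef (a, b)) * c - snd (mcoef (a, b)) * d
      + 2 * (fst (mcoef (a, b)) * fst (mcoef (c, d)) - snd (mcoef (a, b)) * snd (mcoef (c, d))),
      a * snd (mcoef (c, d)) + b * fst (mcoef (c, d)) + fst (mcoef (a, b)) * d + snd (mcoef (a, b)) * c
      + 2 * (fst (mcoef (a, b)) * snd (mcoef (c, d)) + snd (mcoef (a, b)) * fst (mcoef (c, d))))"
    using coef_mult[OF nx, of 0 0] unfolding xy coef_pure[OF assms(2)] coef_pure[OF assms(3)] coef_pure[OF nxy]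
    by (auto simp: quat_defs prod_eq_iff algebra_simps)
  have H: "cact i (mcoef ?z) s A = cact i (a, b) (cact i (mcoef (c, d)) s) A + cact i (mcoef (a, b)) (cact i (c, d) s) A
       + 2 * cact i (mcoef (a, b)) (cact i (mcoef (c, d)) s) A" for s A
    using cact_mult[of i a b "fst (mcoef (c, d))" "snd (mcoef (c, d))"]
      cact_mult[of i "fst (mcoef (a, b))" "snd (mcoef (a, b))" "fst (mcoef (c, d))" "snd (mcoef (c, d))"]
      cact_mult[of i "fst (mcoef (a, b))" "snd (mcoef (a, b))" c d]
    unfolding m by (simp add: cact_def algebra_simps)
  show ?thesis
    unfolding rep1_def op1_comp[OF assms(1) linop_cact linop_cact linop_cact]
    unfolding op1_def by (intro ext) (simp only: H cact_mult)
qed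

lemma rep1_commute:
  assumes "i \<in> {1..n}" "j \<in> {1..n}" "i \<noteq> j" "\<not> adj i j"
  shows "rep1 i z (rep1 j w \<phi>) = rep1 j w (rep1 i z \<phi>)"
  unfolding rep1_def
  by (rule op1_commute[OF assms linop_cact linop_cact]) (rule cact_commute[OF assms])+

end

section \<open>Operators attached to words in the amalgam\<close>

definition e12 :: "mv \<Rightarrow> real \<times> real" where
  "e12 x = (x {}, x {1, 2})"

lemma e12_even2 [simp]: "e12 (even2 a b) = (a, b)"
  using of_mv_mvq[of "Q a b 0 0"] unfolding even2_mvq of_mv_def e12_def by simp

lemma cl_one_even2: "cl_one = even2 1 0"
  by (simp add: even2_mvq cl_one_mvq one_quat_def)

context spin_diagram
begin

definition adj_closed :: "nat set \<Rightarrow> bool" where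
  "adj_closed C \<longleftrightarrow> (\<forall>i\<in>{1..n}. \<forall>j\<in>{1..n}. adj i j \<longrightarrow> (i \<in> C \<longleftrightarrow> j \<in> C))"

text \<open>Vertices outside \<open>C\<close> act trivially; this separates the components of the diagram.\<close>
definition rep1_on :: "nat set \<Rightarrow> nat \<Rightarrow> real \<times> real \<Rightarrow> (nat \<Rightarrow> spinor) \<Rightarrow> nat \<Rightarrow> spinor" where
  "rep1_on C i z \<phi> = (if i \<in> C then rep1 i z \<phi> else \<phi>)"

text \<open>On an edge only the first vertex is tested against C; for \<open>adj_closed C\<close>
  the second one gives the same answer.\<close>

definition letter_op :: "nat set \<Rightarrow> (nat \<times> nat) \<times> mv \<times> mv \<Rightarrow> (nat \<Rightarrow> spinor) \<Rightarrow> nat \<Rightarrow> spinor" where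
  "letter_op C l \<phi> = (case l of ((i, j), g) \<Rightarrow>
     if adj i j then (if i \<in> C then rep2 i j (of_mv (fst g)) \<phi> else \<phi>)
     else rep1_on C i (e12 (fst g)) (rep1_on C j (e12 (snd g)) \<phi>))"

definition word_op :: "nat set \<Rightarrow> ((nat \<times> nat) \<times> mv \<times> mv) list \<Rightarrow> (nat \<Rightarrow> spinor) \<Rightarrow> nat \<Rightarrow> spinor" where
  "word_op C = foldr (letter_op C)"

lemma word_op_simps [simp]: "word_op C [] \<phi> = \<phi>" "word_op C (l # w) \<phi> = letter_op C l (word_op C w \<phi>)"
  "word_op C (v @ w) \<phi> = word_op C v (word_op C w \<phi>)"
  by (simp_all add: word_op_def)

lemma rep1_on_one: "rep1_on C i (1, 0) \<phi> = \<phi>"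
  by (simp add: rep1_on_def rep1_one)

lemma letter_op_mult:
  assumes "(p, g) \<in> letters" "(p, h) \<in> letters"
  shows "letter_op C (p, g) (letter_op C (p, h) \<phi>) = letter_op C (p, g \<otimes>\<^bsub>Gpair adj p\<^esub> h) \<phi>"
proof -
  obtain i j where p: "p = (i, j)" and ij: "i \<in> {1..n}" "j \<in> {1..n}" "i \<noteq> j"
    and gh: "g \<in> carrier (Gpair adj (i, j))" "h \<in> carrier (Gpair adj (i, j))"
    using assms unfolding amal_letters_def by auto
  show ?thesis
  proof (cases "adj i j")
    case True
    then obtain x y where "g = (mvq x, cl_one)" "qnorm x = 1" "h = (mvq y, cl_one)" "qnorm y = 1"
      using gh by (auto simp: Gpair_def G_adj_carrier)
    then show ?thesis using True rep2_mult[OF ij True]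
      by (simp add: p letter_op_def Gpair_def G_adj_def mvq_mult)
  next
    case False
    then have "g \<in> spin 2 \<times> spin 2" "h \<in> spin 2 \<times> spin 2" using gh by (simp_all add: Gpair_def G_nonadj_carrier)
    then obtain a b c d a' b' c' d' where g: "g = (even2 a b, even2 c d)" "a\<^sup>2 + b\<^sup>2 = 1" "c\<^sup>2 + d\<^sup>2 = 1"
      and h: "h = (even2 a' b', even2 c' d')" "a'\<^sup>2 + b'\<^sup>2 = 1" "c'\<^sup>2 + d'\<^sup>2 = 1"
      unfolding spin_2 by auto
    have gh': "g \<otimes>\<^bsub>Gpair adj p\<^esub> h = (even2 (a * a' - b * b') (a * b' + b * a'), even2 (c * c' - d * d') (c * d' + d * c'))"
      using False by (simp add: p g h Gpair_def G_nonadj_def spin_grp_def even2_mult)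
    have comm: "rep1_on C i z (rep1_on C j w \<phi>) = rep1_on C j w (rep1_on C i z \<phi>)" for z w \<phi>
      using rep1_commute[OF ij False] by (simp add: rep1_on_def)
    have mult: "rep1_on C i (a, b) (rep1_on C i (a', b') \<phi>) = rep1_on C i (a * a' - b * b', a * b' + b * a') \<phi>"
      "rep1_on C j (c, d) (rep1_on C j (c', d') \<phi>) = rep1_on C j (c * c' - d * d', c * d' + d * c') \<phi>" for \<phi>
      using rep1_mult[OF ij(1) g(2) h(2)] rep1_mult[OF ij(2) g(3) h(3)] by (simp_all add: rep1_on_def)
    have "letter_op C (p, g) (letter_op C (p, h) \<phi>) =
        rep1_on C i (a, b) (rep1_on C j (c, d) (rep1_on C i (a', b') (rep1_on C j (c', d') \<phi>)))"
      using False by (simp add: p g h letter_op_def)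
    also have "\<dots> = rep1_on C i (a, b) (rep1_on C i (a', b') (rep1_on C j (c, d) (rep1_on C j (c', d') \<phi>)))"
      by (simp only: comm)
    also have "\<dots> = letter_op C (p, g \<otimes>\<^bsub>Gpair adj p\<^esub> h) \<phi>"
      unfolding gh' mult using False by (simp add: p letter_op_def)
    finally show ?thesis .
  qed
qed

lemma letter_op_one:
  assumes "(p, \<one>\<^bsub>Gpair adj p\<^esub>) \<in> letters"
  shows "letter_op C (p, \<one>\<^bsub>Gpair adj p\<^esub>) \<phi> = \<phi>"
proof -
  obtain i j where p: "p = (i, j)" and ij: "i < j" using assms unfolding amal_letters_def by auto
  show ?thesis
  proof (cases "adj i j")
    case True
    then show ?thesis using rep2_i[of i j 1 0 \<phi>] ij
      by (simp add: p Gpair_def G_adj_def letter_op_def cl_one_mvq one_quat_def rep1_one)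
  next
    case False
    then show ?thesis
      by (simp add: p Gpair_def G_nonadj_def spin_grp_def letter_op_def cl_one_even2 rep1_on_one)
  qed
qed

text \<open>The right side does not mention j, which is what the identification relations of the
  amalgam need.\<close>

lemma letter_op_emb:
  assumes "adj_closed C" "i \<in> {1..n}" "j \<in> {1..n}" "i \<noteq> j" "a\<^sup>2 + b\<^sup>2 = 1"
  shows "letter_op C (pair i j, emb adj i j (even2 a b)) \<phi> = rep1_on C i (a, b) \<phi>"
proof (cases "adj i j")
  case True
  have ji: "adj j i" "i \<in> C \<longleftrightarrow> j \<in> C" using True assms(1-3) adj_sym[OF assms(2,3)] unfolding adj_closed_def by blast+
  have "emb adj i j (even2 a b) = (if i < j then (mvq (Q a b 0 0), cl_one) else (mvq (Q a 0 b 0), cl_one))"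
    using True arg_cong[OF e12_even2[of a b], of fst] arg_cong[OF e12_even2[of a b], of snd]
    unfolding emb_def cl_ab_12 cl_ab_23 e12_def by simp
  then show ?thesis
    using True assms(4) ji rep2_i[OF assms(4,5)] rep2_j[of j i, OF _ assms(5)]
    by (auto simp: letter_op_def pair_def rep1_on_def min_def max_def)
next
  case False
  then have "\<not> adj j i" using assms adj_sym by blast
  then show ?thesis using False assms(4)
    by (auto simp: emb_nonadj letter_op_def pair_def min_def max_def rep1_on_one cl_one_even2)
qed

text \<open>Every closed C thus yields a representation of the enveloping group.\<close>

lemma word_op_cong:
  assumes "u \<simeq> v" "adj_closed C"
  shows "word_op C u = word_op C v"
  using assms(1)
proof (rule wcong_invariant)
  fix u v x y assume "amal_rel n adj u v"
  then have "word_op C u \<phi> = word_op C v \<phi>" for \<phi>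
    unfolding amal_rel_def
  proof (elim disjE exE conjE)
    fix i j k x assume ijk: "i \<in> {1..n}" "j \<in> {1..n}" "k \<in> {1..n}" "i \<noteq> j" "i \<noteq> k" and x: "x \<in> spin 2"
      and uv: "u = [(pair i j, emb adj i j x)]" "v = [(pair i k, emb adj i k x)]"
    obtain a b where "x = even2 a b" "a\<^sup>2 + b\<^sup>2 = 1" using x unfolding spin_2 by auto
    then show "word_op C u \<phi> = word_op C v \<phi>"
      using ijk uv letter_op_emb[OF assms(2)] by simp
  qed (simp_all add: letter_op_mult letter_op_one)
  then show "word_op C (x @ u @ y) = word_op C (x @ v @ y)" by (rule_tac ext) simp
qed

lemma word_op_sl:
  assumes "adj_closed C" "i \<in> {1..n}"
  shows "word_op C (sl i t) \<phi> = rep1_on C i (cos t, sin t) \<phi>"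
  using letter_op_emb[OF assms other(1)[OF assms(2)] other(2)[symmetric], of "cos t" "sin t"]
  by (simp add: sl_def S_rot_even2)

text \<open>At t = pi/2 one has cos 3t = cos t = 0 and sin 3t = -sin t, so the rank-one term
  vanishes.\<close>

lemma rep1_half_pi: "rep1 i (0, 1) \<phi> = (\<lambda>k. gam i (\<phi> k))"
  by (intro ext) (simp add: rep1_def op1_def mcoef_def cact_def)

definition half :: "nat \<Rightarrow> spinor \<Rightarrow> spinor" where
  "half i = cact i (sqrt 2 / 2, sqrt 2 / 2)"

lemma linop_half: "linop (half i)"
  by (simp add: half_def linop_cact)

text \<open>At angle \<open>\<pi>/4\<close> the action is the tensor product of a spin operator with a simple reflection.\<close>
lemma rep1_diag: "rep1 i (r, r) \<phi> = (\<lambda>k. cact i (r, r) (\<lambda>A. simple_refl n adj i (\<lambda>k. \<phi> k A) k))"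
proof (intro ext)
  fix k A
  have "mcoef (r, r) = (- r, - r)" by (simp add: mcoef_def)
  then show "rep1 i (r, r) \<phi> k A = cact i (r, r) (\<lambda>A. simple_refl n adj i (\<lambda>k. \<phi> k A) k) A"
    by (simp add: rep1_def op1_def cact_def simple_refl_def cart_def gam_def algebra_simps)
qed

definition lift :: "nat list \<Rightarrow> (nat \<times> bool) list" where
  "lift u = map (\<lambda>i. (i, True)) u"

definition dw :: "nat list \<Rightarrow> (nat \<times> bool) list" where
  "dw a = concat (map (\<lambda>i. gen_pow i 2) a)"

lemma adj_closed_UNIV: "adj_closed UNIV"
  by (simp add: adj_closed_def)

lemma simple_refl_linop: "linop F \<Longrightarrow> (\<lambda>A. simple_refl n adj i (\<lambda>k. F (\<phi> k) A) k) = F (\<lambda>A. simple_refl n adj i (\<lambda>k. \<phi> k A) k)"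
proof
  fix A assume F: "linop F"
  have "(\<lambda>A. simple_refl n adj i (\<lambda>k. \<phi> k A) k) = (\<lambda>A. \<phi> k A + (if k = i then -1 else 0) * cart i \<phi> A)"
    by (auto simp: simple_refl_def cart_def)
  moreover have "F (\<lambda>A. \<phi> k A + (if k = i then -1 else 0) * cart i \<phi> A) A =
      F (\<phi> k) A + (if k = i then -1 else 0) * F (cart i \<phi>) A"
    by (simp only: linop_add[OF F] linop_scale[OF F])
  ultimately show "simple_refl n adj i (\<lambda>k. F (\<phi> k) A) k = F (\<lambda>A. simple_refl n adj i (\<lambda>k. \<phi> k A) k) A"
    using fun_cong[OF cart_linop[OF F, of i \<phi>], of A] by (simp add: simple_refl_def cart_def)
qed

lemma linop_foldr: "(\<And>i. linop (f i)) \<Longrightarrow> linop (foldr f u)"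
  by (induction u) (simp_all add: linop_def)

text \<open>Each letter is a tensor product and operators on V commute with linear ones on S, so the
  two factors multiply separately.\<close>

lemma word_op_lift:
  assumes "u \<in> lists {1..n}"
  shows "word_op UNIV (tr (lift u)) \<phi> = (\<lambda>k. foldr half u (\<lambda>A. act u (\<lambda>k. \<phi> k A) k))"
  using assms
proof (induction u)
  case (Cons i u)
  let ?s = "\<lambda>k A. act u (\<lambda>k. \<phi> k A) k"
  have "word_op UNIV (tr (lift (i # u))) \<phi> = rep1 i (sqrt 2 / 2, sqrt 2 / 2) (\<lambda>k. foldr half u (?s k))"
    using Cons word_op_sl[OF adj_closed_UNIV, of i "pi / 4"]
    by (simp add: lift_def rep1_on_def cos_45 sin_45)
  also have "\<dots> = (\<lambda>k. half i (foldr half u (\<lambda>A. simple_refl n adj i (\<lambda>k. ?s k A) k)))"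
    unfolding rep1_diag simple_refl_linop[OF linop_foldr[OF linop_half]] half_def ..
  finally show ?case by simp
qed (simp add: lift_def)

definition gam_word :: "nat set \<Rightarrow> nat list \<Rightarrow> spinor \<Rightarrow> spinor" where
  "gam_word C = foldr (\<lambda>i s. if i \<in> C then gam i s else s)"

lemma word_op_dw:
  assumes "adj_closed C" "a \<in> lists {1..n}"
  shows "word_op C (tr (dw a)) \<phi> = (\<lambda>k. gam_word C a (\<phi> k))"
  using assms(2)
proof (induction a)
  case (Cons i a)
  then have i: "i \<in> {1..n}" by simp
  have "word_op C (tr (gen_pow i 2)) \<psi> = rep1_on C i (0, 1) \<psi>" for \<psi>
    using word_op_cong[OF tr_gen_pow[OF i, of 2] assms(1)] word_op_sl[OF assms(1) i, of "pi / 2"] by simp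
  then have "word_op C (tr (dw (i # a))) \<phi> = rep1_on C i (0, 1) (\<lambda>k. gam_word C a (\<phi> k))"
    using Cons by (simp add: dw_def)
  then show ?case by (simp add: rep1_on_def rep1_half_pi gam_word_def)
qed (simp add: dw_def gam_word_def)

lemma gam_neq_0: "gam i s A \<noteq> 0 \<longleftrightarrow> s (sym_diff A {i}) \<noteq> 0"
  using gsgn_sq[of i "sym_diff A {i}"] by (auto simp: gam_def)

text \<open>Up to sign, a product of the g_i translates the index sets by the set of letters of odd
  multiplicity.\<close>

lemma gam_word_neq_0:
  "gam_word UNIV a s A \<noteq> 0 \<longleftrightarrow> s {i. (i \<in> A) \<noteq> odd (count_list a i)} \<noteq> 0"
proof (induction a arbitrary: A)
  case (Cons j a)
  have "{i. (i \<in> sym_diff A {j}) \<noteq> odd (count_list a i)} = {i. (i \<in> A) \<noteq> odd (count_list (j # a) i)}"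
    by auto
  then show ?case using Cons by (simp add: gam_word_def gam_neq_0)
qed (simp add: gam_word_def)

end

section \<open>Injectivity\<close>

context spin_diagram
begin

section \<open>Normal form: squares followed by a positive word\<close>

abbreviation wspin_eq (infix "\<sim>" 50) where "u \<sim> v \<equiv> wcong (wspin_rel n adj) u v"

lemma dw_simps [simp]: "dw [] = []" "dw (i # a) = gen_pow i 2 @ dw a" "dw (a @ b) = dw a @ dw b"
  by (simp_all add: dw_def)

lemma lift_simps [simp]: "lift [] = []" "lift (i # u) = (i, True) # lift u" "lift (u @ v) = lift u @ lift v"
  by (simp_all add: lift_def)

lemma gen_pow_add: "gen_pow i k @ gen_pow i l = gen_pow i (k + l)"
  by (simp add: gen_pow_def replicate_add)

lemma gen_pow_1: "gen_pow i 1 = [(i, True)]" "gen_pow i 2 = [(i, True), (i, True)]" "gen_pow i 0 = []"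
  by (simp_all add: gen_pow_def numeral_2_eq_2)

lemma gen_pow_Suc: "(i, True) # gen_pow i k = gen_pow i (Suc k)" "gen_pow i k @ [(i, True)] = gen_pow i (Suc k)"
  by (simp_all add: gen_pow_def replicate_append_same)

lemma cancel_letter: "i \<in> {1..n} \<Longrightarrow> [(i, b), (i, \<not> b)] \<sim> []"
  by (rule wcong_rel) (auto simp: wspin_rel_def)

lemma pow_8: "i \<in> {1..n} \<Longrightarrow> gen_pow i 8 \<sim> []"
  by (rule wcong_rel) (auto simp: wspin_rel_def)

lemma conj_rel:
  "\<lbrakk>i \<in> {1..n}; j \<in> {1..n}; i \<noteq> j\<rbrakk> \<Longrightarrow>
    [(i, False)] @ gen_pow j 2 @ [(i, True)] \<sim> gen_pow j 2 @ gen_pow i (2 * n_coef adj i j)"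
  by (rule wcong_rel) (unfold wspin_rel_def, blast)

lemma alt_rel:
  "\<lbrakk>i \<in> {1..n}; j \<in> {1..n}; i \<noteq> j\<rbrakk> \<Longrightarrow>
    alt_word i j (m_coef adj i j) \<sim> alt_word j i (m_coef adj i j)"
  by (rule wcong_rel) (unfold wspin_rel_def, blast)

lemma square_right:
  assumes "i \<in> {1..n}" "j \<in> {1..n}" "i \<noteq> j"
  shows "gen_pow j 2 @ [(i, True)] \<sim> [(i, True)] @ gen_pow j 2 @ gen_pow i (2 * n_coef adj i j)"
proof -
  have "gen_pow j 2 @ [(i, True)] \<sim> [(i, True), (i, False)] @ gen_pow j 2 @ [(i, True)]"
    using wcong_appendR[OF wc_sym[OF cancel_letter[OF assms(1), of True]], of "gen_pow j 2 @ [(i, True)]"] by simp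
  also have "\<dots> \<sim> [(i, True)] @ gen_pow j 2 @ gen_pow i (2 * n_coef adj i j)"
    using wcong_appendL[OF conj_rel[OF assms], of "[(i, True)]"] by simp
  finally show ?thesis .
qed

text \<open>The conjugation relation, read backwards, moves r_j^2 to the left of r_i at the cost of
  further squares of r_i.\<close>

lemma letter_square:
  assumes "i \<in> {1..n}" "j \<in> {1..n}"
  shows "\<exists>a\<in>lists {1..n}. (i, True) # gen_pow j 2 \<sim> dw a @ [(i, True)]"
proof (cases "i = j")
  case True
  then show ?thesis using assms by (intro bexI[of _ "[i]"]) (simp_all add: gen_pow_1 wc_refl)
next
  case False
  let ?k = "2 * n_coef adj i j"
  have k: "?k = 0 \<or> ?k = 2" by (simp add: n_coef_def)
  have "(i, True) # gen_pow j 2 = [(i, True)] @ gen_pow j 2 @ []" by simp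
  \<comment> \<open>The exponent \<open>4 * ?k\<close> is 0 or 8, so nothing changes. One share
    \<open>?k\<close> completes the right side of \<open>square_right\<close>; the remaining
    \<open>3 * ?k\<close> replaces the negative power r_i^(-2).\<close>
  also have "\<dots> \<sim> [(i, True)] @ gen_pow j 2 @ gen_pow i (4 * ?k)"
    using k pow_8[OF assms(1)] wc_refl by (intro wcong_appendL) (auto simp: gen_pow_1 intro: wc_sym)
  also have "\<dots> = ([(i, True)] @ gen_pow j 2 @ gen_pow i ?k) @ gen_pow i (3 * ?k)"
    by (simp add: gen_pow_add)
  also have "\<dots> \<sim> (gen_pow j 2 @ [(i, True)]) @ gen_pow i (3 * ?k)"
    by (intro wcong_appendR wc_sym[OF square_right] assms False)
  also have "\<dots> = (gen_pow j 2 @ gen_pow i (3 * ?k)) @ [(i, True)]"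
    by (simp add: gen_pow_Suc)
  also have "gen_pow j 2 @ gen_pow i (3 * ?k) = dw (j # (if ?k = 0 then [] else [i, i, i]))"
    using k by (auto simp: gen_pow_def numeral_eq_Suc)
  finally show ?thesis using assms by (intro bexI[of _ "j # (if ?k = 0 then [] else [i, i, i])"]) auto
qed

lemma letter_dw:
  assumes "i \<in> {1..n}" "a \<in> lists {1..n}"
  shows "\<exists>b\<in>lists {1..n}. (i, True) # dw a \<sim> dw b @ [(i, True)]"
  using assms(2)
proof (induction a)
  case Nil
  show ?case by (intro bexI[of _ "[]"]) (simp_all add: wc_refl)
next
  case (Cons j a)
  obtain b where b: "b \<in> lists {1..n}" "(i, True) # dw a \<sim> dw b @ [(i, True)]" using Cons by blast
  obtain c where c: "c \<in> lists {1..n}" "(i, True) # gen_pow j 2 \<sim> dw c @ [(i, True)]"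
    using letter_square[OF assms(1)] Cons by blast
  have "(i, True) # dw (j # a) \<sim> dw c @ (i, True) # dw a"
    using wcong_appendR[OF c(2), of "dw a"] by simp
  also have "\<dots> \<sim> dw (c @ b) @ [(i, True)]" using wcong_appendL[OF b(2), of "dw c"] by simp
  finally show ?case using b c by (intro bexI[of _ "c @ b"]) auto
qed

lemma lift_dw:
  assumes "u \<in> lists {1..n}" "a \<in> lists {1..n}"
  shows "\<exists>b\<in>lists {1..n}. lift u @ dw a \<sim> dw b @ lift u"
  using assms(1)
proof (induction u)
  case Nil
  show ?case using assms(2) by (intro bexI[of _ a]) (simp_all add: wc_refl)
next
  case (Cons i u)
  then obtain b where b: "b \<in> lists {1..n}" "lift u @ dw a \<sim> dw b @ lift u" by blast
  obtain c where c: "c \<in> lists {1..n}" "(i, True) # dw b \<sim> dw c @ [(i, True)]"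
    using letter_dw[of i b] b Cons by blast
  have "lift (i # u) @ dw a \<sim> ((i, True) # dw b) @ lift u"
    using wcong_appendL[OF b(2), of "[(i, True)]"] by simp
  also have "\<dots> \<sim> dw c @ lift (i # u)" using wcong_appendR[OF c(2), of "lift u"] by simp
  finally show ?case using c(1) by blast
qed

lemma normal_form:
  assumes "w \<in> lists ({1..n} \<times> UNIV)"
  shows "\<exists>a\<in>lists {1..n}. \<exists>u\<in>lists {1..n}. w \<sim> dw a @ lift u"
  using assms
proof (induction w)
  case Nil
  show ?case by (intro bexI[of _ "[]"]) (simp_all add: wc_refl)
next
  case (Cons l w)
  obtain i b where l: "l = (i, b)" "i \<in> {1..n}" using Cons.hyps by auto
  obtain a u where au: "a \<in> lists {1..n}" "u \<in> lists {1..n}" "w \<sim> dw a @ lift u" using Cons by blast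
  have "\<exists>c\<in>lists {1..n}. [(i, b)] \<sim> dw c @ [(i, True)]"
  proof (cases b)
    case True
    then show ?thesis by (intro bexI[of _ "[]"]) (simp_all add: wc_refl)
  next
    case False
    \<comment> \<open>The inverse of r_i is r_i^7, that is, three squares followed by r_i.\<close>
    have "[(i, b)] \<sim> [(i, False)] @ gen_pow i 8"
      using False wcong_appendL[OF wc_sym[OF pow_8[OF l(2)]], of "[(i, False)]"] by simp
    also have "\<dots> = [(i, False), (i, True)] @ gen_pow i 7"
      by (simp add: gen_pow_Suc)
    also have "\<dots> \<sim> gen_pow i 7"
      using wcong_appendR[OF cancel_letter[OF l(2), of False], of "gen_pow i 7"] by simp
    also have "gen_pow i 7 = dw [i, i, i] @ [(i, True)]"
      by (simp add: gen_pow_def numeral_eq_Suc)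
    finally show ?thesis using l(2) by (intro bexI[of _ "[i, i, i]"]) auto
  qed
  then obtain c where c: "c \<in> lists {1..n}" "[(i, b)] \<sim> dw c @ [(i, True)]" by blast
  obtain d where d: "d \<in> lists {1..n}" "(i, True) # dw a \<sim> dw d @ [(i, True)]"
    using letter_dw[OF l(2) au(1)] by blast
  have "l # w \<sim> (dw c @ [(i, True)]) @ dw a @ lift u"
    using wcong_append[OF c(2) au(3)] by (simp add: l)
  also have "\<dots> \<sim> dw (c @ d) @ lift (i # u)"
    using wcong_subst[OF d(2), of "dw c" "lift u"] by simp
  finally show ?case using c d au l by (intro bexI[of _ "c @ d"] bexI[of _ "i # u"]) auto
qed

text \<open>Words in the squares \<open>r\<^sub>i\<^sup>2\<close>, which generate the kernel of the projection to the Coxeter group.\<close>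
definition deq :: "nat list \<Rightarrow> nat list \<Rightarrow> bool" (infix "\<doteq>" 50) where
  "a \<doteq> b \<longleftrightarrow> dw a \<sim> dw b"

lemma deq_refl: "a \<doteq> a" and deq_sym: "a \<doteq> b \<Longrightarrow> b \<doteq> a"
  and deq_trans [trans]: "a \<doteq> b \<Longrightarrow> b \<doteq> c \<Longrightarrow> a \<doteq> c"
  by (auto simp: deq_def intro: wc_refl wc_sym wc_trans)

lemma deq_append: "a \<doteq> b \<Longrightarrow> c \<doteq> d \<Longrightarrow> a @ c \<doteq> b @ d"
  by (simp add: deq_def wcong_append)

lemma deq_subst: "a \<doteq> b \<Longrightarrow> x @ a @ y \<doteq> x @ b @ y"
  by (intro deq_append deq_refl)

lemma deq_4: "i \<in> {1..n} \<Longrightarrow> [i, i, i, i] \<doteq> []"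
  using pow_8[of i] by (simp add: deq_def gen_pow_add)

lemma dw_inverse:
  assumes "a \<in> lists {1..n}"
  shows "\<exists>b\<in>lists {1..n}. b @ a \<doteq> []"
  using assms
proof (induction a)
  case Nil
  show ?case by (intro bexI[of _ "[]"]) (simp_all add: deq_refl)
next
  case (Cons i a)
  then obtain b where b: "b \<in> lists {1..n}" "b @ a \<doteq> []" by blast
  have "(b @ [i, i, i]) @ i # a \<doteq> b @ a"
    using deq_subst[OF deq_4[of i], of b a] Cons.hyps by simp
  with b Cons.hyps show ?case by (intro bexI[of _ "b @ [i, i, i]"]) (auto intro: deq_trans)
qed

text \<open>The Coxeter relations other than i i = 1 hold verbatim in \<open>Wspin\<close>; that one
  leaves a factor r_i^2, which \<open>lift_dw\<close> moves to the front. Hence the kernel of the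
  projection to the Coxeter group consists of products of squares.\<close>

lemma cox_lift:
  "u \<approx> v \<Longrightarrow> u \<in> lists {1..n} \<Longrightarrow> \<exists>a\<in>lists {1..n}. lift u \<sim> dw a @ lift v"
proof (induction rule: wcong.induct)
  case (wc_base u v x y)
  then have x: "x \<in> lists {1..n}" by simp
  consider i where "i \<in> {1..n}" "u = [i, i]" "v = []" | "lift u \<sim> lift v"
  proof -
    from wc_base(1) show thesis unfolding cox_rel_def
    proof (elim disjE bexE conjE)
      fix i j assume ij: "i \<in> {1..n}" "j \<in> {1..n}" "i \<noteq> j" "adj i j" "u = [i, j, i]" "v = [j, i, j]"
      then show thesis using that(2) alt_rel[OF ij(1-3)] by (simp add: m_coef_def alt_word_2_3)
    next
      fix i j assume ij: "i \<in> {1..n}" "j \<in> {1..n}" "i \<noteq> j" "\<not> adj i j" "u = [i, j]" "v = [j, i]"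
      then show thesis using that(2) alt_rel[OF ij(1-3)] by (simp add: m_coef_def alt_word_2_3)
    qed (use that(1) in blast)
  qed
  then show ?case
  proof cases
    case (1 i)
    obtain b where b: "b \<in> lists {1..n}" "lift x @ dw [i] \<sim> dw b @ lift x" using lift_dw[OF x, of "[i]"] 1 by auto
    have "lift (x @ u @ y) = (lift x @ dw [i]) @ lift y" using 1 by (simp add: gen_pow_1)
    also have "\<dots> \<sim> (dw b @ lift x) @ lift y" by (intro wcong_appendR b)
    finally show ?thesis using b(1) 1(3) by (intro bexI[of _ b]) auto
  next
    case 2
    then show ?thesis using wcong_subst[OF 2, of "lift x" "lift y"] by (intro bexI[of _ "[]"]) auto
  qed
next
  case (wc_refl u)
  show ?case by (intro bexI[of _ "[]"]) (simp_all add: wcong.wc_refl)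
next
  case (wc_sym u v)
  have "u \<in> lists {1..n}" using cox_lists[OF wc_sym(1)] wc_sym(3) by blast
  then obtain a where a: "a \<in> lists {1..n}" "lift u \<sim> dw a @ lift v" using wc_sym.IH by blast
  obtain b where b: "b \<in> lists {1..n}" "b @ a \<doteq> []" using dw_inverse[OF a(1)] by blast
  have "dw b @ lift u \<sim> dw (b @ a) @ lift v" using wcong_appendL[OF a(2), of "dw b"] by simp
  also have "\<dots> \<sim> lift v" using wcong_appendR[of "wspin_rel n adj" "dw (b @ a)" "[]" "lift v"] b(2) by (simp add: deq_def)
  finally show ?case using b(1) wcong.wc_sym by blast
next
  case (wc_trans u v w)
  then obtain a where a: "a \<in> lists {1..n}" "lift u \<sim> dw a @ lift v" by blast
  have "v \<in> lists {1..n}" using cox_lists[OF wc_trans(1)] wc_trans by blast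
  then obtain b where b: "b \<in> lists {1..n}" "lift v \<sim> dw b @ lift w" using wc_trans.IH by blast
  have "lift u \<sim> dw a @ dw b @ lift w" using wcong.wc_trans[OF a(2) wcong_appendL[OF b(2)]] .
  then show ?case using a(1) b(1) by (intro bexI[of _ "a @ b"]) auto
qed

text \<open>A letter i of these words is r_i^2. Each of its two factors r_i, on passing r_j^2 with j
  adjacent, leaves r_i^2 behind, in total r_i^4.\<close>

lemma deq_swap:
  assumes "i \<in> {1..n}" "j \<in> {1..n}" "i \<noteq> j"
  shows "[j, i] \<doteq> (if adj i j then [i, j, i, i] else [i, j])"
proof -
  let ?k = "2 * n_coef adj i j"
  have "dw [j, i] = (gen_pow j 2 @ [(i, True)]) @ [(i, True)]" by (simp add: gen_pow_1)
  also have "\<dots> \<sim> ([(i, True)] @ gen_pow j 2 @ gen_pow i ?k) @ [(i, True)]"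
    by (intro wcong_appendR square_right assms)
  also have "\<dots> = [(i, True)] @ (gen_pow j 2 @ [(i, True)]) @ gen_pow i ?k"
    by (simp add: gen_pow_Suc)
  also have "\<dots> \<sim> [(i, True)] @ ([(i, True)] @ gen_pow j 2 @ gen_pow i ?k) @ gen_pow i ?k"
    by (intro wcong_subst square_right assms)
  also have "\<dots> = dw (if adj i j then [i, j, i, i] else [i, j])"
    by (simp add: gen_pow_1 gen_pow_add n_coef_def) (simp add: gen_pow_def numeral_eq_Suc)
  finally show ?thesis by (simp add: deq_def)
qed

text \<open>Moving two letters i past j creates r_i^4 twice, and r_i^8 = 1.\<close>

lemma deq_central:
  assumes "i \<in> {1..n}" "j \<in> {1..n}"
  shows "[j, i, i] \<doteq> [i, i, j]"
proof (cases "i = j")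
  case False
  show ?thesis
  proof (cases "adj i j")
    case True
    have sw: "[j, i] \<doteq> [i, j, i, i]" using deq_swap[OF assms False] True by simp
    have "[j, i, i] \<doteq> [i, j, i, i, i]" using deq_subst[OF sw, of "[]" "[i]"] by simp
    also have "\<dots> \<doteq> [i, i, j, i, i, i, i]" using deq_subst[OF sw, of "[i]" "[i, i]"] by simp
    also have "\<dots> \<doteq> [i, i, j]" using deq_subst[OF deq_4[OF assms(1)], of "[i, i, j]" "[]"] by simp
    finally show ?thesis .
  next
    case False2: False
    have sw: "[j, i] \<doteq> [i, j]" using deq_swap[OF assms False] False2 by simp
    have "[j, i, i] \<doteq> [i, j, i]" using deq_subst[OF sw, of "[]" "[i]"] by simp
    also have "\<dots> \<doteq> [i, i, j]" using deq_subst[OF sw, of "[i]" "[]"] by simp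
    finally show ?thesis .
  qed
qed (simp add: deq_refl)

text \<open>Inserting the swap of (i, j) into the swap of (j, i) gives j i = j i (j j i i), so r_j^4
  r_i^4 = 1, and r_i^4 is its own inverse.\<close>

lemma deq_adj:
  assumes "i \<in> {1..n}" "j \<in> {1..n}" "adj i j"
  shows "[i, i] \<doteq> [j, j]"
proof -
  have ij: "i \<noteq> j" "adj j i" using assms adj_irrefl adj_sym by blast+
  have 1: "[j, i] \<doteq> [i, j, i, i]" "[i, j] \<doteq> [j, i, j, j]"
    using deq_swap[OF assms(1,2)] deq_swap[OF assms(2,1)] ij assms(3) by auto
  obtain b where b: "b @ [j, i] \<doteq> []" using dw_inverse[of "[j, i]"] assms by auto
  have "[j, i] \<doteq> [j, i, j, j, i, i]"
    using deq_trans[OF 1(1)] deq_subst[OF 1(2), of "[]" "[i, i]"] by simp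
  then have "b @ [j, i] \<doteq> (b @ [j, i]) @ [j, j, i, i]"
    using deq_append[OF deq_refl[of b]] by simp
  also have "\<dots> \<doteq> [j, j, i, i]" using deq_append[OF b deq_refl] by simp
  finally have "[] \<doteq> [j, j, i, i]" using b deq_sym deq_trans by blast
  then have "[i, i] \<doteq> [j, j, i, i, i, i]" using deq_append[OF _ deq_refl[of "[i, i]"]] by fastforce
  also have "\<dots> \<doteq> [j, j]" using deq_subst[OF deq_4[OF assms(1)], of "[j, j]" "[]"] by simp
  finally show ?thesis .
qed

text \<open>\<open>zz\<close> lists the central elements \<open>r\<^sub>i\<^sup>4\<close>.\<close>
definition zz :: "nat list \<Rightarrow> nat list" where
  "zz b = concat (map (\<lambda>i. [i, i]) b)"

lemma zz_simps [simp]: "zz [] = []" "zz (i # b) = i # i # zz b" "zz (a @ b) = zz a @ zz b"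
  by (simp_all add: zz_def)

lemma zz_lists [simp]: "zz b \<in> lists S \<longleftrightarrow> b \<in> lists S"
  by (induction b) auto

lemma zz_central:
  assumes "a \<in> lists {1..n}" "b \<in> lists {1..n}"
  shows "a @ zz b \<doteq> zz b @ a"
proof -
  have 1: "j # zz b \<doteq> zz b @ [j]" if "j \<in> {1..n}" for j
    using assms(2)
  proof (induction b)
    case (Cons i b)
    have "j # zz (i # b) \<doteq> [i, i] @ j # zz b"
      using deq_subst[OF deq_central[of i j], of "[]" "zz b"] Cons that by simp
    also have "\<dots> \<doteq> [i, i] @ zz b @ [j]" using Cons by (intro deq_append deq_refl) auto
    finally show ?case by simp
  qed (simp add: deq_refl)
  show ?thesis using assms(1)
  proof (induction a)
    case (Cons j a)
    have "(j # a) @ zz b \<doteq> [j] @ zz b @ a" using deq_append[OF deq_refl[of "[j]"], of "a @ zz b"] Cons by simp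
    also have "\<dots> \<doteq> (zz b @ [j]) @ a" using deq_append[OF 1[of j] deq_refl[of a]] Cons by simp
    finally show ?case by simp
  qed (simp add: deq_refl)
qed

text \<open>The squares commute up to central elements, which are collected in
  \<open>zz b\<close>.\<close>

lemma move_right:
  assumes "i \<in> {1..n}" "p \<in> lists {1..n}"
  shows "\<exists>b\<in>lists {1..n}. i # p \<doteq> zz b @ p @ [i]"
  using assms(2)
proof (induction p)
  case Nil
  show ?case by (intro bexI[of _ "[]"]) (simp_all add: deq_refl)
next
  case (Cons j p)
  then have j: "j \<in> {1..n}" and p: "p \<in> lists {1..n}" by auto
  obtain b where b: "b \<in> lists {1..n}" "i # p \<doteq> zz b @ p @ [i]" using Cons by blast
  have "\<exists>c\<in>lists {1..n}. [i, j] \<doteq> zz c @ [j, i]"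
  proof (cases "i = j \<or> \<not> adj j i")
    case True
    then have "[i, j] \<doteq> zz [] @ [j, i]"
      using deq_swap[OF j assms(1)] by (cases "i = j") (auto simp: deq_refl)
    then show ?thesis by (rule bexI) simp
  next
    case False
    then have "[i, j] \<doteq> [j, i] @ zz [j]" using deq_swap[OF j assms(1)] by auto
    also have "\<dots> \<doteq> zz [j] @ [j, i]" using j assms(1) by (intro zz_central) auto
    finally show ?thesis using j by (intro bexI[of _ "[j]"]) auto
  qed
  then obtain c where c: "c \<in> lists {1..n}" "[i, j] \<doteq> zz c @ [j, i]" by blast
  have "i # j # p \<doteq> (zz c @ [j]) @ i # p" using deq_append[OF c(2) deq_refl[of p]] by simp
  also have "\<dots> \<doteq> (zz c @ [j]) @ zz b @ p @ [i]" by (intro deq_append deq_refl b)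
  also have "\<dots> = zz c @ ([j] @ zz b) @ p @ [i]" by simp
  also have "\<dots> \<doteq> zz c @ (zz b @ [j]) @ p @ [i]" using j b(1) by (intro deq_subst zz_central) auto
  finally show ?case using b(1) c(1) by (intro bexI[of _ "c @ b"]) auto
qed

text \<open>The first letter is moved next to its next occurrence; the pair becomes a central r_i^4,
  and the rest is shorter with even counts.\<close>

lemma even_counts_zz:
  assumes "a \<in> lists {1..n}" "\<And>i. even (count_list a i)"
  shows "\<exists>b\<in>lists {1..n}. a \<doteq> zz b"
  using assms
proof (induction "length a" arbitrary: a rule: less_induct)
  case less
  show ?case
  proof (cases a)
    case Nil
    then show ?thesis by (intro bexI[of _ "[]"]) (simp_all add: deq_refl)
  next
    case (Cons i r)
    have "i \<in> set r"
    proof (rule ccontr)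
      assume "i \<notin> set r"
      then have "count_list a i = 1" using Cons by simp
      then show False using less.prems(2)[of i] by simp
    qed
    then obtain p q where r: "r = p @ i # q" using split_list by metis
    have L: "i \<in> {1..n}" "p \<in> lists {1..n}" "q \<in> lists {1..n}" using less.prems(1) by (auto simp: Cons r)
    obtain b where b: "b \<in> lists {1..n}" "i # p \<doteq> zz b @ p @ [i]" using move_right[OF L(1,2)] by blast
    have "even (count_list (p @ q) k)" for k
      using less.prems(2)[of k] by (cases "k = i") (auto simp: Cons r)
    then obtain c where c: "c \<in> lists {1..n}" "p @ q \<doteq> zz c"
      using less.hyps[of "p @ q"] L by (auto simp: Cons r)
    have "a \<doteq> (zz b @ p @ [i]) @ i # q" using deq_append[OF b(2) deq_refl[of "i # q"]] by (simp add: Cons r)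
    also have "\<dots> = zz b @ (p @ zz [i]) @ q" by simp
    also have "\<dots> \<doteq> zz b @ (zz [i] @ p) @ q" using L by (intro deq_subst zz_central) auto
    also have "\<dots> = (zz b @ zz [i]) @ p @ q" by simp
    also have "\<dots> \<doteq> (zz b @ zz [i]) @ zz c" by (intro deq_append deq_refl c)
    finally show ?thesis using L b(1) c(1) by (intro bexI[of _ "b @ i # c"]) auto
  qed
qed

section \<open>Components of the diagram and the central elements r_i^4\<close>

definition adj_rel :: "(nat \<times> nat) set" where
  "adj_rel = {(i, j). i \<in> {1..n} \<and> j \<in> {1..n} \<and> adj i j}"

lemma adj_rel_zz: "(i, j) \<in> adj_rel\<^sup>* \<Longrightarrow> [i, i] \<doteq> [j, j]"
proof (induction rule: rtrancl_induct)
  case (step y z)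
  then have "[y, y] \<doteq> [z, z]" using deq_adj by (auto simp: adj_rel_def)
  with step show ?case using deq_trans by blast
qed (rule deq_refl)

lemma adj_closed_rtrancl: "adj_closed C \<Longrightarrow> (i, j) \<in> adj_rel\<^sup>* \<Longrightarrow> i \<in> C \<longleftrightarrow> j \<in> C"
  by (erule rtrancl_induct) (auto simp: adj_closed_def adj_rel_def)

lemma adj_closed_component: "adj_closed {j. (i, j) \<in> adj_rel\<^sup>*}"
proof -
  have "(j, k) \<in> adj_rel" "(k, j) \<in> adj_rel" if "j \<in> {1..n}" "k \<in> {1..n}" "adj j k" for j k
    using that adj_sym by (auto simp: adj_rel_def)
  then show ?thesis unfolding adj_closed_def by (blast intro: rtrancl_into_rtrancl)
qed

text \<open>Within a component all r_i^4 coincide and have square 1, so an even number of them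
  cancels.\<close>

lemma zz_trivial:
  assumes "b \<in> lists {1..n}" "\<And>C. adj_closed C \<Longrightarrow> even (length (filter (\<lambda>i. i \<in> C) b))"
  shows "zz b \<doteq> []"
  using assms
proof (induction "length b" arbitrary: b rule: less_induct)
  case less
  show ?case
  proof (cases b)
    case (Cons i r)
    let ?C = "{j. (i, j) \<in> adj_rel\<^sup>*}"
    \<comment> \<open>The component of i contains i, so evenness forces a second letter from
      it.\<close>
    have "filter (\<lambda>j. j \<in> ?C) r \<noteq> []"
      using less.prems(2)[OF adj_closed_component[of i]] by (auto simp: Cons)
    then obtain j where j: "j \<in> set r" "(i, j) \<in> adj_rel\<^sup>*" by (auto simp: filter_empty_conv)
    then obtain p q where r: "r = p @ j # q" using split_list by metis
    have L: "i \<in> {1..n}" "j \<in> {1..n}" "p \<in> lists {1..n}" "q \<in> lists {1..n}"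
      using less.prems(1) by (auto simp: Cons r)
    have "even (length (filter (\<lambda>i. i \<in> C) (p @ q)))" if "adj_closed C" for C
      using less.prems(2)[OF that] adj_closed_rtrancl[OF that j(2)] by (auto simp: Cons r split: if_splits)
    then have IH: "zz (p @ q) \<doteq> []" using less.hyps[of "p @ q"] L by (auto simp: Cons r)
    have "zz b = [i, i] @ (zz p @ zz [j]) @ zz q" by (simp add: Cons r)
    also have "\<dots> \<doteq> [i, i] @ (zz [j] @ zz p) @ zz q" using L by (intro deq_subst zz_central) auto
    also have "\<dots> = [i, i] @ [j, j] @ zz (p @ q)" by simp
    also have "\<dots> \<doteq> [i, i] @ [i, i] @ zz (p @ q)"
      by (intro deq_subst deq_sym[OF adj_rel_zz[OF j(2)]])
    also have "\<dots> \<doteq> zz (p @ q)" using deq_subst[OF deq_4[OF L(1)], of "[]" "zz (p @ q)"] by simp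
    also note IH
    finally show ?thesis .
  qed (simp add: deq_refl)
qed

lemma gam_word_zz:
  "gam_word C (zz b) s = (\<lambda>A. (-1) ^ length (filter (\<lambda>i. i \<in> C) b) * s A)"
proof (induction b)
  case (Cons i b)
  have "gam i (gam i s) = (\<lambda>A. - s A)" for s by (rule gam_gam)
  with Cons show ?case by (simp add: gam_word_def)
qed (simp add: gam_word_def)

section \<open>Triviality of the kernel\<close>

lemma tr_trivialD:
  assumes "w \<in> lists ({1..n} \<times> UNIV)" "tr w \<simeq> []"
  shows "w \<sim> []"
proof -
  obtain a u where au: "a \<in> lists {1..n}" "u \<in> lists {1..n}" "w \<sim> dw a @ lift u" using normal_form[OF assms(1)] by blast
  have triv: "word_op C (tr w) \<phi> = \<phi>" if "adj_closed C" for C \<phi>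
    using word_op_cong[OF assms(2) that] by simp
  have au_op: "gam_word UNIV a (foldr half u (\<lambda>A. act u (\<lambda>k. \<phi> k A) k)) = \<phi> k" for \<phi> k
    using fun_cong[OF triv[OF adj_closed_UNIV, of \<phi>], of k] word_op_cong[OF tr_cong[OF au(3)] adj_closed_UNIV]
      word_op_dw[OF adj_closed_UNIV au(1)] word_op_lift[OF au(2)] by simp
  have act0: "act u v 0 = v 0" for v
    using au(2) by (induction u) (auto simp: simple_refl_def)
  \<comment> \<open>Index 0 is not a vertex, so reflections leave it fixed and only the S-factor is
    seen there. Knowing that this factor is exactly 1, without scalar ambiguity, isolates the
    V-factor in \<open>key\<close>.\<close>
  have "gam_word UNIV a (foldr half u s) = s" for s
    using au_op[of "\<lambda>k. s" 0] by (simp add: act0)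
  then have key: "(\<lambda>A. act u (\<lambda>k. \<phi> k A) k) = \<phi> k" for \<phi> :: "nat \<Rightarrow> spinor" and k
    using au_op[of \<phi> k] by simp
  \<comment> \<open>Families of constant spinors embed V into V (x) S.\<close>
  have "act u v k = v k" for v k using fun_cong[OF key[of "\<lambda>k A. v k" k]] by simp
  then have "act u = id" by (simp add: fun_eq_iff)
  then have "u \<approx> []" using act_faithful[OF au(2)] by simp
  then obtain c where c: "c \<in> lists {1..n}" "lift u \<sim> dw c" using cox_lift[of u "[]"] au(2) by auto
  define d where "d = a @ c"
  have d: "d \<in> lists {1..n}" using au c by (simp add: d_def)
  have wd: "w \<sim> dw d" using wc_trans[OF au(3) wcong_appendL[OF c(2)]] by (simp add: d_def)
  have gd: "gam_word C d s = s" if C: "adj_closed C" for C s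
    using fun_cong[OF triv[OF C, of "\<lambda>k. s"]] word_op_cong[OF tr_cong[OF wd] C] word_op_dw[OF C d] by simp
  have "even (count_list d i)" for i
  proof -
    \<comment> \<open>The spinor 1: its coefficient at \<open>{}\<close> can survive only if no
      letter of d has odd multiplicity.\<close>
    let ?s = "\<lambda>A. if A = {} then 1 else 0::real"
    have "{i. (i \<in> {}) \<noteq> odd (count_list d i)} = {}"
      using gam_word_neq_0[of d ?s "{}"] gd[OF adj_closed_UNIV, of ?s] by (simp split: if_splits)
    then show ?thesis by auto
  qed
  then obtain b where b: "b \<in> lists {1..n}" "d \<doteq> zz b" using even_counts_zz[OF d] by blast
  have wb: "w \<sim> dw (zz b)" using wc_trans[OF wd] b(2) by (simp add: deq_def)
  have zb: "zz b \<in> lists {1..n}" using b(1) by simp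
  have "even (length (filter (\<lambda>i. i \<in> C) b))" if C: "adj_closed C" for C
  proof -
    have "gam_word C (zz b) (\<lambda>_. 1) = (\<lambda>_. 1)"
      using fun_cong[OF triv[OF C, of "\<lambda>k _. 1"]] word_op_cong[OF tr_cong[OF wb] C] word_op_dw[OF C zb] by simp
    then have "(-1) ^ length (filter (\<lambda>i. i \<in> C) b) = (1::real)"
      unfolding gam_word_zz by (simp add: fun_eq_iff)
    then show ?thesis by (simp add: minus_one_power_iff split: if_splits)
  qed
  then have "zz b \<doteq> []" using zz_trivial[OF b(1)] by blast
  then show ?thesis using wc_trans[OF wb] by (simp add: deq_def)
qed

end

section \<open>The isomorphism\<close>

context spin_diagram
begin

definition inv_word :: "(nat \<times> bool) list \<Rightarrow> (nat \<times> bool) list" where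
  "inv_word w = rev (map (\<lambda>(i, b). (i, \<not> b)) w)"

lemma inv_word_simps [simp]: "inv_word [] = []" "inv_word ((i, b) # w) = inv_word w @ [(i, \<not> b)]"
  by (simp_all add: inv_word_def)

lemma inv_word_lists: "w \<in> lists ({1..n} \<times> UNIV) \<Longrightarrow> inv_word w \<in> lists ({1..n} \<times> UNIV)"
  by (induction w) (auto simp: inv_word_def)

lemma inv_word:
  assumes "w \<in> lists ({1..n} \<times> UNIV)"
  shows "inv_word w @ w \<sim> []" "w @ inv_word w \<sim> []"
proof -
  have "inv_word w @ w \<sim> [] \<and> w @ inv_word w \<sim> []"
    using assms
  proof (induction w)
    case (Cons l w)
    obtain i b where l: "l = (i, b)" "i \<in> {1..n}" using Cons.hyps by auto
    have "inv_word (l # w) @ l # w \<sim> inv_word w @ w"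
      using wcong_subst[OF cancel_letter[OF l(2), of "\<not> b"], of "inv_word w" w] by (simp add: l)
    moreover have "(l # w) @ inv_word (l # w) \<sim> [l] @ [] @ [(i, \<not> b)]"
      using wcong_subst[of _ "w @ inv_word w" "[]" "[l]" "[(i, \<not> b)]"] Cons by (simp add: l)
    moreover have "[l] @ [] @ [(i, \<not> b)] \<sim> []" using cancel_letter[OF l(2)] by (simp add: l)
    ultimately show ?case using Cons.IH wc_trans by blast
  qed (simp add: wc_refl)
  then show "inv_word w @ w \<sim> []" "w @ inv_word w \<sim> []" by auto
qed

lemma tr_inject:
  assumes "u \<in> lists ({1..n} \<times> UNIV)" "v \<in> lists ({1..n} \<times> UNIV)" "tr u \<simeq> tr v"
  shows "u \<sim> v"
proof -
  have "tr (inv_word v @ u) \<simeq> tr (inv_word v @ v)" using wcong_appendL[OF assms(3)] by simp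
  also have "\<dots> \<simeq> tr []" by (intro tr_cong inv_word assms)
  finally have "inv_word v @ u \<sim> []"
    using assms inv_word_lists by (intro tr_trivialD) auto
  then have "v @ inv_word v @ u \<sim> v" using wcong_appendL[of _ "inv_word v @ u" "[]" v] by simp
  moreover have "v @ inv_word v @ u \<sim> u" using wcong_appendR[OF inv_word(2)[OF assms(2)], of u] by simp
  ultimately show ?thesis by (blast intro: wc_sym wc_trans)
qed

lemma tr_lists: "w \<in> lists ({1..n} \<times> UNIV) \<Longrightarrow> tr w \<in> lists letters"
proof (induction w)
  case (Cons l w)
  obtain i b where l: "l = (i, b)" "i \<in> {1..n}" using Cons.prems by auto
  have "sl i t \<in> lists letters" for t
    using emb_letter[OF l(2) other(1)[OF l(2)] other(2)[symmetric]] by (simp add: sl_def)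
  then show ?case using Cons by (simp add: l)
qed simp

lemma s_hat_tr: "s_hat n adj i = wclass (amal_rel n adj) (tr [(i, True)])"
  by (simp add: s_hat_def s_hat_via_def tau_def sl_def other_def)

lemma s_hat_via_indep:
  assumes "i \<in> {1..n}" "j \<in> {1..n}" "k \<in> {1..n}" "i \<noteq> j" "i \<noteq> k"
  shows "s_hat_via n adj i j = s_hat_via n adj i k"
  using sl_via[OF assms(1,2,4), of "pi / 4"] sl_via[OF assms(1,3,5), of "pi / 4"]
  unfolding s_hat_via_def tau_def wclass_eq_iff by (blast intro: wc_sym wc_trans)

text \<open>The order divides 8 by the relation r_i^8 = 1, and does not divide 4 because r_i^4 acts
  as g_i^2 = -1.\<close>

lemma ord_s_hat:
  assumes i: "i \<in> {1..n}"
  shows "group.ord (SpinPi n adj) (s_hat n adj i) = 8"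
proof -
  interpret group "SpinPi n adj" by (rule group_SpinPi)
  have carr: "s_hat n adj i \<in> carrier (SpinPi n adj)"
    unfolding s_hat_tr SpinPi_def word_group_simps using i by (intro imageI tr_lists) auto
  have "concat (replicate k (tr [(i, True)])) = tr (gen_pow i k)" for k
    by (induction k) (simp_all add: gen_pow_def)
  then have pow: "s_hat n adj i [^]\<^bsub>SpinPi n adj\<^esub> k = \<one>\<^bsub>SpinPi n adj\<^esub> \<longleftrightarrow> tr (gen_pow i k) \<simeq> []" for k :: nat
    unfolding s_hat_tr SpinPi_def word_group_pow word_group_simps wclass_eq_iff by simp
  have "tr (gen_pow i 8) \<simeq> []" using tr_cong[OF pow_8[OF i]] by simp
  then have "ord (s_hat n adj i) dvd 2 ^ 3" using pow[of 8] pow_eq_id[OF carr, of 8] by simp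
  then obtain e where e: "e \<le> 3" "ord (s_hat n adj i) = 2 ^ e"
    using divides_primepow_nat[OF two_is_prime_nat] by blast
  have "\<not> tr (gen_pow i 4) \<simeq> []"
  proof
    assume "tr (gen_pow i 4) \<simeq> []"
    moreover have "gen_pow i 4 = dw [i, i]" by (simp add: gen_pow_add)
    ultimately have "word_op UNIV (tr (dw [i, i])) (\<lambda>k _. 1) = (\<lambda>k _. 1)"
      using word_op_cong[OF _ adj_closed_UNIV] by fastforce
    then have "gam_word UNIV [i, i] (\<lambda>_. 1) = (\<lambda>_. 1)"
      using word_op_dw[OF adj_closed_UNIV, of "[i, i]"] i by (simp add: fun_eq_iff)
    then show False by (simp add: gam_word_def gam_gam fun_eq_iff)
  qed
  then have "\<not> ord (s_hat n adj i) dvd 2 ^ 2" using pow[of 4] pow_eq_id[OF carr, of 4] by simp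
  then have "\<not> e \<le> 2" using e(2) le_imp_power_dvd[of e 2 "2::nat"] by auto
  then have "e = 3" using e(1) by simp
  then show ?thesis using e(2) by simp
qed

text \<open>Defined on whole classes as the union of the classes of all translated members, so no
  representative has to be chosen.\<close>

definition hom_W :: "(nat \<times> bool) list set \<Rightarrow> ((nat \<times> nat) \<times> mv \<times> mv) list set" where
  "hom_W A = {v. \<exists>w\<in>A. tr w \<simeq> v}"

lemma hom_W: "hom_W (wclass (wspin_rel n adj) w) = wclass (amal_rel n adj) (tr w)"
  unfolding hom_W_def wclass_def by (auto intro: wc_refl wc_trans tr_cong)

lemma W_hat_carrier:
  "carrier (W_hat n adj) = (\<lambda>w. wclass (amal_rel n adj) (tr w)) ` lists ({1..n} \<times> UNIV)"
proof -
  let ?W = "lists ({1..n} \<times> (UNIV :: bool set))" and ?c = "\<lambda>w. wclass (amal_rel n adj) (tr w)"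
  interpret group "SpinPi n adj" by (rule group_SpinPi)
  have mult: "?c u \<otimes>\<^bsub>SpinPi n adj\<^esub> ?c v = ?c (u @ v)" for u v
    by (simp add: SpinPi_def word_group_mult)
  have one: "\<one>\<^bsub>SpinPi n adj\<^esub> = ?c []" by (simp add: SpinPi_def word_group_simps)
  have inv: "inv\<^bsub>SpinPi n adj\<^esub> (s_hat n adj i) = ?c [(i, False)]" if i: "i \<in> {1..n}" for i
    unfolding s_hat_tr SpinPi_def
  proof (rule word_group_inv_letter)
    show "group (word_group letters (amal_rel n adj))" using group_SpinPi by (simp add: SpinPi_def)
    show "tr [(i, True)] \<in> lists letters" "tr [(i, False)] \<in> lists letters" using i
      by (simp_all only: tr_lists lists.intros mem_Sigma_iff UNIV_I Cons_in_lists_iff)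
    show "tr [(i, False)] @ tr [(i, True)] \<simeq> []" using tr_cong[OF cancel_letter[OF i, of False]] by simp
  qed
  have "generate (SpinPi n adj) (s_hat n adj ` {1..n}) = ?c ` ?W"
  proof (intro equalityI subsetI)
    fix x assume "x \<in> generate (SpinPi n adj) (s_hat n adj ` {1..n})"
    then show "x \<in> ?c ` ?W"
    proof induction
      case one
      show ?case unfolding \<open>\<one>\<^bsub>SpinPi n adj\<^esub> = _\<close> by (intro imageI) simp
    next
      case (incl x)
      then obtain i where i: "i \<in> {1..n}" "x = s_hat n adj i" by blast
      show ?case unfolding i(2) s_hat_tr using i(1) by (intro imageI) simp
    next
      case (inv x)
      then obtain i where i: "i \<in> {1..n}" "x = s_hat n adj i" by blast
      show ?case unfolding i(2) \<open>\<And>i. i \<in> {1..n} \<Longrightarrow> inv\<^bsub>SpinPi n adj\<^esub> (s_hat n adj i) = _\<close>[OF i(1)]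
        using i(1) by (intro imageI) simp
    next
      case (eng x y)
      then obtain u v where "u \<in> ?W" "x = ?c u" "v \<in> ?W" "y = ?c v" by blast
      then show ?case using mult[of u v] by (metis append_in_lists_conv imageI)
    qed
  next
    fix x assume "x \<in> ?c ` ?W"
    then obtain w where w: "w \<in> ?W" "x = ?c w" by blast
    have "?c w \<in> generate (SpinPi n adj) (s_hat n adj ` {1..n})" using w(1)
    proof induction
      case Nil
      show ?case using generate.one[of "SpinPi n adj"] one by simp
    next
      case (Cons l w)
      obtain i b where l: "l = (i, b)" "i \<in> {1..n}" using Cons.hyps by auto
      have "?c [l] \<in> generate (SpinPi n adj) (s_hat n adj ` {1..n})"
      proof (cases b)
        case True
        then show ?thesis using generate.incl[OF imageI[OF l(2), of "s_hat n adj"]] by (simp only: l(1) s_hat_tr)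
      next
        case False
        then show ?thesis using generate.inv[OF imageI[OF l(2), of "s_hat n adj"], of "SpinPi n adj"] inv[OF l(2)]
            by (simp add: l(1))
      qed
      from generate.eng[OF this Cons.IH] show ?case using mult[of "[l]" w] by simp
    qed
    then show "x \<in> generate (SpinPi n adj) (s_hat n adj ` {1..n})" by (simp add: w(2))
  qed
  then show ?thesis by (simp add: W_hat_def)
qed

lemma hom_W_iso: "hom_W \<in> iso (Wspin n adj) (W_hat n adj)"
proof -
  let ?W = "lists ({1..n} \<times> (UNIV :: bool set))" and ?R = "wspin_rel n adj"
  have carr: "carrier (Wspin n adj) = wclass ?R ` ?W" by (simp add: Wspin_def word_group_simps)
  have "hom_W \<in> hom (Wspin n adj) (W_hat n adj)"
  proof (rule homI)
    fix x assume "x \<in> carrier (Wspin n adj)"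
    then show "hom_W x \<in> carrier (W_hat n adj)" unfolding carr W_hat_carrier by (auto simp: hom_W)
  next
    fix x y assume "x \<in> carrier (Wspin n adj)" "y \<in> carrier (Wspin n adj)"
    then obtain u v where "x = wclass ?R u" "y = wclass ?R v" unfolding carr by blast
    then show "hom_W (x \<otimes>\<^bsub>Wspin n adj\<^esub> y) = hom_W x \<otimes>\<^bsub>W_hat n adj\<^esub> hom_W y"
      by (simp add: Wspin_def W_hat_def SpinPi_def word_group_mult hom_W)
  qed
  moreover have "inj_on hom_W (carrier (Wspin n adj))"
    unfolding carr by (intro inj_onI, elim imageE) (simp only: hom_W wclass_eq_iff tr_inject)
  moreover have "hom_W ` carrier (Wspin n adj) = carrier (W_hat n adj)"
    unfolding carr W_hat_carrier image_image hom_W ..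
  ultimately show ?thesis by (simp add: iso_def bij_betw_def)
qed

end

theorem theorem2:
  fixes n :: nat and adj :: "nat \<Rightarrow> nat \<Rightarrow> bool"
  assumes "n \<ge> 2"
    and "\<And>i j. i \<in> {1..n} \<Longrightarrow> j \<in> {1..n} \<Longrightarrow> adj i j = adj j i"
    and "\<And>i. i \<in> {1..n} \<Longrightarrow> \<not> adj i i"
  shows "(\<forall>i\<in>{1..n}. \<forall>j\<in>{1..n}. \<forall>k\<in>{1..n}. i \<noteq> j \<longrightarrow> i \<noteq> k \<longrightarrow>
            s_hat_via n adj i j = s_hat_via n adj i k)
       \<and> (\<forall>i\<in>{1..n}. group.ord (SpinPi n adj) (s_hat n adj i) = 8)
       \<and> (\<exists>h. h \<in> iso (Wspin n adj) (W_hat n adj) \<and>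
              (\<forall>i\<in>{1..n}. h (r_gen n adj i) = s_hat n adj i))"
proof -
  interpret spin_diagram n adj using assms by unfold_locales
  show ?thesis
    using s_hat_via_indep ord_s_hat hom_W_iso hom_W s_hat_tr unfolding r_gen_def by blast
qed

end
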